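(* Consider the Markov-modulated JSQ system with $n$ servers described in the context, parametrized by $\epsilon=1-\lambda/\mu_\Sigma$. Let $f:\mathcal Z\to\mathbb R$ be any function such that a solution $V_f$ to the Poisson equation for $f$ exists and satisfies $\mathbb E[|V_f(\widetilde Z)|^{1+\xi}]<\infty$ for some $\xi>0$. Then, for all $s>0$, as $\epsilon\downarrow0$, $$\mathrm{Cov}\left(e^{-s\epsilon\widetilde q_\Sigma},f(\widetilde Z)\right)=(e^{-s\epsilon}-1)\,\mathbb E\left[e^{-s\epsilon\widetilde q_\Sigma}\,V_f(\widetilde Z)\left(\lambda_{\widetilde Z}-\mu_{\widetilde Z\Sigma}\right)\right]+O\left(\epsilon^{2-\frac1{1+\xi}}\right),$$ where $\widetilde q_\Sigma=\sum_{j=1}^n\widetilde q_j$.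
   Context: Modulating chain. $\{Z(t):t\ge0\}$ is an ergodic continuous-time Markov chain (CTMC) on a countable state space $\mathcal Z$ with transition rate matrix $[\alpha_{ii'}]_{i,i'\in\mathcal Z}$ and stationary distribution $\pi$; $\alpha_{i\bullet}:=\sum_{i'\ne i}\alpha_{ii'}$ and $\sup_i\alpha_{i\bullet}<\infty$. JSQ system. There are $n$ servers, each with its own infinite-buffer queue; $\boldsymbol q(t)=(q_1(t),\dots,q_n(t))\in\mathbb Z_+^n$ is the vector of queue lengths (including jobs in service). Given nonnegative rates $\lambda_i$ and $\mu_{ij}$ ($i\in\mathcal Z$, $1\le j\le n$), the pair $(Z(t),\boldsymbol q(t))$ is a CTMC with the following transitions from state $(i,\boldsymbol q)$: an arrival at rate $\lambda_i$, which increases by 1 the length of a shortest queue (Join-the-Shortest-Queue, ties broken at random); for each $j$ with $q_j>0$, a departure at rate $\mu_{ij}$ which decreases $q_j$ by 1; and for each $i'\neq i$ a change of the first coordinate from $i$ to $i'$ at rate $\alpha_{ii'}$. There are finite constants $\lambda_{\max},\mu_{\max}$ with $\lambda_i<\lambda_{\max}$, $\mu_{ij}<\mu_{\max}$ for all $i,j$. Averages. $\mu_{i\Sigma}:=\sum_{j=1}^n\mu_{ij}$; $\lambda:=\sum_i\pi_i\lambda_i$, $\mu_j:=\sum_i\pi_i\mu_{ij}$, $\mu_\Sigma:=\sum_{j}\mu_j$. Heavy traffic. $\rho:=\lambda/\mu_\Sigma$ and $\epsilon:=1-\rho$. We consider a family of systems indexed by small $\epsilon>0$ in which all $\mu_{ij}$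 and $\alpha_{ii'}$ are fixed and only the arrival rates $\lambda_i$ depend on $\epsilon$, with $\lambda=(1-\epsilon)\mu_\Sigma$; $\lambda_{\max}$ and $\mu_{\max}$ do not depend on $\epsilon$. For every such $\epsilon$, $(Z(t),\boldsymbol q(t))$ is positive recurrent; $(\widetilde Z,\widetilde{\boldsymbol q})$ denotes a random element with its stationary distribution (so $\widetilde Z\sim\pi$), and $\mathbb E$, $\mathrm{Cov}$ are under this distribution. $O(\cdot)$ is as $\epsilon\downarrow0$ with $s$, $f$, $V_f$ fixed. Poisson equation. For $f:\mathcal Z\to\mathbb R$ with $\bar f=\mathbb E[f(\widetilde Z)]$, a solution to the Poisson equation for $f$ is a function $V_f:\mathcal Z\to\mathbb R$ with $$V_f(i)=\frac{f(i)-\bar f}{\alpha_{i\bullet}}+\sum_{i'\ne i}\frac{\alpha_{ii'}}{\alpha_{i\bullet}}V_f(i')\qquad\text{for all } i\in\mathcal Z.$$ *)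

theory Defs
  imports "HOL-Probability.Probability" "HOL-Library.Landau_Symbols"
begin

section \<open>Continuous-time Markov chains\<close>

text \<open>
  Transition rates are given by a function \<open>r\<close>, where \<open>r x y\<close> is the rate of
  moving from \<open>x\<close> to \<open>y \<noteq> x\<close>. Values \<open>r x x\<close> are never used; the diagonal of the
  rate matrix is minus the total outgoing rate (the chain is conservative).
\<close>

definition is_rates :: "('s \<Rightarrow> 's \<Rightarrow> real) \<Rightarrow> bool" where
  "is_rates r \<longleftrightarrow>
     (\<forall>x y. x \<noteq> y \<longrightarrow> 0 \<le> r x y) \<and> (\<forall>x. (\<lambda>y. r x y) summable_on (- {x}))"

definition out_rate :: "('s \<Rightarrow> 's \<Rightarrow> real) \<Rightarrow> 's \<Rightarrow> real" where
  "out_rate r x = infsum (\<lambda>y. r x y) (- {x})"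

definition rate_matrix :: "('s \<Rightarrow> 's \<Rightarrow> real) \<Rightarrow> 's \<Rightarrow> 's \<Rightarrow> real" where
  "rate_matrix r x y = (if y = x then - out_rate r x else r x y)"

text \<open>
  A continuous-time Markov chain is represented by its transition function: \<open>P t x\<close>
  is the distribution at time \<open>t\<close> of the chain started in \<open>x\<close>. It is an honest
  (total mass one) Markov semigroup whose derivative at time zero is the rate matrix.
  When the total outgoing rates are bounded, it is uniquely determined by the rates
  on nonnegative times.
\<close>

definition is_ctmc :: "('s \<Rightarrow> 's \<Rightarrow> real) \<Rightarrow> (real \<Rightarrow> 's \<Rightarrow> 's pmf) \<Rightarrow> bool" where
  "is_ctmc r P \<longleftrightarrow>
     is_rates r \<and>
     (\<forall>x. P 0 x = return_pmf x) \<and>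
     (\<forall>s\<ge>0. \<forall>t\<ge>0. \<forall>x. P (s + t) x = bind_pmf (P s x) (P t)) \<and>
     (\<forall>x y. ((\<lambda>t. pmf (P t x) y) has_real_derivative rate_matrix r x y) (at_right 0))"

definition stationary :: "(real \<Rightarrow> 's \<Rightarrow> 's pmf) \<Rightarrow> 's pmf \<Rightarrow> bool" where
  "stationary P \<pi> \<longleftrightarrow> (\<forall>t\<ge>0. bind_pmf \<pi> (P t) = \<pi>)"

definition irreducible_chain :: "(real \<Rightarrow> 's \<Rightarrow> 's pmf) \<Rightarrow> bool" where
  "irreducible_chain P \<longleftrightarrow> (\<forall>x y. \<exists>t\<ge>0. 0 < pmf (P t x) y)"

text \<open>
  A state \<open>x\<close> is positive recurrent if the return probabilities \<open>P t x x\<close> have a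
  positive limit as \<open>t\<close> tends to infinity. (The limit exists for every such semigroup;
  for a non-absorbing state it is the reciprocal of the outgoing rate times the mean
  return time, and zero if the latter is infinite.)
\<close>

definition positive_recurrent :: "(real \<Rightarrow> 's \<Rightarrow> 's pmf) \<Rightarrow> bool" where
  "positive_recurrent P \<longleftrightarrow> (\<forall>x. \<exists>l>0. ((\<lambda>t. pmf (P t x) x) \<longlongrightarrow> l) at_top)"

definition ergodic_chain :: "(real \<Rightarrow> 's \<Rightarrow> 's pmf) \<Rightarrow> bool" where
  "ergodic_chain P \<longleftrightarrow> irreducible_chain P \<and> positive_recurrent P"

section \<open>Poisson equation and covariance\<close>

text \<open>
  The well-definedness of \<open>f\<close>'s mean and of the series in the Poisson equation is made
  explicit.
\<close>

definition poisson_solution ::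
    "('z \<Rightarrow> 'z \<Rightarrow> real) \<Rightarrow> 'z pmf \<Rightarrow> ('z \<Rightarrow> real) \<Rightarrow> ('z \<Rightarrow> real) \<Rightarrow> bool" where
  "poisson_solution \<alpha> \<pi> f V \<longleftrightarrow>
     integrable (measure_pmf \<pi>) f \<and>
     (\<forall>i. (\<lambda>i'. \<alpha> i i' / out_rate \<alpha> i * V i') summable_on (- {i}) \<and>
          V i = (f i - measure_pmf.expectation \<pi> f) / out_rate \<alpha> i
                + infsum (\<lambda>i'. \<alpha> i i' / out_rate \<alpha> i * V i') (- {i}))"

definition covariance :: "'a measure \<Rightarrow> ('a \<Rightarrow> real) \<Rightarrow> ('a \<Rightarrow> real) \<Rightarrow> real" where
  "covariance M X Y =
     integral\<^sup>L M (\<lambda>w. (X w - integral\<^sup>L M X) * (Y w - integral\<^sup>L M Y))"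

section \<open>The Markov-modulated Join-the-Shortest-Queue system\<close>

text \<open>The servers are the elements of the finite type \<open>'n\<close>.\<close>

type_synonym 'n queues = "(nat, 'n) vec"

definition shortest :: "'n::finite queues \<Rightarrow> 'n set" where
  "shortest q = {j. \<forall>k. q $ j \<le> q $ k}"

definition add_job :: "'n::finite \<Rightarrow> 'n queues \<Rightarrow> 'n queues" where
  "add_job j q = (\<chi> k. if k = j then q $ k + 1 else q $ k)"

definition remove_job :: "'n::finite \<Rightarrow> 'n queues \<Rightarrow> 'n queues" where
  "remove_job j q = (\<chi> k. if k = j then q $ k - 1 else q $ k)"

definition total_queue :: "'n::finite queues \<Rightarrow> real" where
  "total_queue q = real (\<Sum>j\<in>UNIV. q $ j)"

text \<open>
  Ties are broken uniformly at random: each shortest queue receives the arrivals at an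
  equal share of the total arrival rate.
\<close>

definition jsq_rates ::
    "('z \<Rightarrow> 'z \<Rightarrow> real) \<Rightarrow> ('z \<Rightarrow> real) \<Rightarrow> ('z \<Rightarrow> 'n::finite \<Rightarrow> real)
      \<Rightarrow> 'z \<times> 'n queues \<Rightarrow> 'z \<times> 'n queues \<Rightarrow> real" where
  "jsq_rates \<alpha> lam \<mu> x y =
     (case (x, y) of ((i, q), (i', q')) \<Rightarrow>
        if i' = i then
          (\<Sum>j\<in>shortest q. if q' = add_job j q then lam i / real (card (shortest q)) else 0)
          + (\<Sum>j | 0 < q $ j. if q' = remove_job j q then \<mu> i j else 0)
        else if q' = q then \<alpha> i i' else 0)"

definition mean_arrival_rate :: "'z pmf \<Rightarrow> ('z \<Rightarrow> real) \<Rightarrow> real" where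
  "mean_arrival_rate \<pi> lam = measure_pmf.expectation \<pi> lam"

definition mean_service_rate :: "'z pmf \<Rightarrow> ('z \<Rightarrow> 'n \<Rightarrow> real) \<Rightarrow> 'n \<Rightarrow> real" where
  "mean_service_rate \<pi> \<mu> j = measure_pmf.expectation \<pi> (\<lambda>i. \<mu> i j)"

definition load :: "'z pmf \<Rightarrow> ('z \<Rightarrow> real) \<Rightarrow> ('z \<Rightarrow> 'n::finite \<Rightarrow> real) \<Rightarrow> real" where
  "load \<pi> lam \<mu> = mean_arrival_rate \<pi> lam / (\<Sum>j\<in>UNIV. mean_service_rate \<pi> \<mu> j)"

end

theory Submission
  imports Defs
begin

text \<open>
  Testing stationarity of the joint chain against \<open>exp (- a * total_queue q) * V i\<close> with
  \<open>a = s * \<epsilon>\<close>, the Poisson equation turns the modulating part of the generator into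
  \<open>- exp (- a * total_queue q) * (f i - E f)\<close>, and the identity reads
  \<open>Cov = E [exp (- a * total_queue q) * V i * (lam i * (exp (- a) - 1) + busy * (exp a - 1))]\<close>,
  where \<open>busy\<close> is the total service rate of the nonempty queues. Replacing \<open>busy\<close> by the full
  service rate costs a term of order \<open>\<epsilon>\<^sup>2\<close> and a term \<open>(exp a - 1) * E [\<bar>V\<bar> * idle]\<close>. The same
  identity with \<open>V = 1\<close> and \<open>a \<rightarrow> 0\<close> shows that the mean idle service rate is \<open>O(\<epsilon>)\<close>;
  truncating \<open>\<bar>V\<bar>\<close> at the level \<open>\<epsilon> powr (- 1 / (1 + \<xi>))\<close> gives
  \<open>E [\<bar>V\<bar> * idle] = O(\<epsilon> powr (\<xi> / (1 + \<xi>)))\<close>.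
\<close>

section \<open>Global balance\<close>

text \<open>The diagonal values of \<open>r\<close> are arbitrary. Setting them to zero lets sums
  over jump targets run over the whole type, as integrals over
  \<open>count_space UNIV\<close>.\<close>

definition jump_rate :: "('s \<Rightarrow> 's \<Rightarrow> real) \<Rightarrow> 's \<Rightarrow> 's \<Rightarrow> real" where
  "jump_rate r x y = (if y = x then 0 else r x y)"

text \<open>Inflow into \<open>y\<close> equals outflow from \<open>y\<close>: the stationarity
  equation for the rate matrix with its diagonal term moved to the right. The extended nonnegative
  integral gives the inflow a meaning before its finiteness is known.\<close>

definition globally_balanced :: "('s \<Rightarrow> 's \<Rightarrow> real) \<Rightarrow> 's pmf \<Rightarrow> bool" where
  "globally_balanced r p \<longleftrightarrow>
     (\<forall>y. (\<integral>\<^sup>+x. ennreal (jump_rate r x y) \<partial>measure_pmf p) = ennreal (pmf p y * out_rate r y))"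

text \<open>For real families summability is absolute summability, so infinite sums over states
  become Lebesgue integrals and the convergence and Fubini theorems apply to them.\<close>

lemma has_sum_imp_integrable_count_space:
  fixes f :: "'a \<Rightarrow> real"
  assumes "(f has_sum S) A"
  shows "integrable (count_space A) f" "(\<integral>x. f x \<partial>count_space A) = S"
proof -
  have s: "f summable_on A" using assms by (rule has_sum_imp_summable)
  then have a: "Infinite_Set_Sum.abs_summable_on f A"
    using summable_on_iff_abs_summable_on_real abs_summable_equivalent by blast
  then show "integrable (count_space A) f" by (simp add: abs_summable_on_def)
  show "(\<integral>x. f x \<partial>count_space A) = S"
    using infsetsum_infsum[OF a] infsumI[OF assms] by (simp add: infsetsum_def)
qed

lemma jump_rate_nonneg: "is_rates r \<Longrightarrow> 0 \<le> jump_rate r x y"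
  by (auto simp: is_rates_def jump_rate_def)

lemma has_sum_jump_rate:
  assumes "((\<lambda>y. r x y * g y) has_sum S) (- {x})"
  shows "((\<lambda>y. jump_rate r x y * g y) has_sum S) UNIV"
  using assms by (subst has_sum_cong_neutral[where T = "- {x}" and g = "\<lambda>y. r x y * g y"])
    (auto simp: jump_rate_def)

lemma out_rate_nonneg: "is_rates r \<Longrightarrow> 0 \<le> out_rate r x"
  unfolding out_rate_def by (intro infsum_nonneg) (auto simp: is_rates_def)

lemma integrable_jump_rate:
  assumes "is_rates r"
  shows "integrable (count_space UNIV) (jump_rate r x)"
    "(\<integral>y. jump_rate r x y \<partial>count_space UNIV) = out_rate r x"
proof -
  have "((\<lambda>y. r x y) has_sum out_rate r x) (- {x})"
    unfolding out_rate_def using assms by (auto simp: is_rates_def)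
  then have "((\<lambda>y. jump_rate r x y * 1) has_sum out_rate r x) UNIV"
    by (intro has_sum_jump_rate) simp
  from has_sum_imp_integrable_count_space[OF this]
  show "integrable (count_space UNIV) (jump_rate r x)"
    "(\<integral>y. jump_rate r x y \<partial>count_space UNIV) = out_rate r x" by simp_all
qed

lemma nn_integral_jump_rate:
  assumes "is_rates r"
  shows "(\<integral>\<^sup>+y. ennreal (jump_rate r x y) \<partial>count_space UNIV) = ennreal (out_rate r x)"
  using nn_integral_eq_integral[OF integrable_jump_rate(1)[OF assms]]
    integrable_jump_rate(2)[OF assms] jump_rate_nonneg[OF assms] by simp

text \<open>Finiteness allows the two integrals to be subtracted; a counting measure has no nonempty
  null sets, so a difference with integral zero vanishes everywhere.\<close>

lemma nn_integral_eq_imp_eq: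
  assumes "\<And>x. f x \<le> (g x :: ennreal)" "(\<integral>\<^sup>+x. f x \<partial>count_space UNIV) = (\<integral>\<^sup>+x. g x \<partial>count_space UNIV)"
    "(\<integral>\<^sup>+x. f x \<partial>count_space UNIV) < \<infinity>"
  shows "f x = g x"
proof -
  have "(\<integral>\<^sup>+x. g x - f x \<partial>count_space UNIV) = 0"
    using assms by (subst nn_integral_diff) auto
  then have "g x - f x = 0"
    by (subst (asm) nn_integral_0_iff_AE) (auto simp: AE_count_space)
  then show ?thesis using assms(1)[of x]
    by (metis diff_eq_0_iff_ennreal order_antisym_conv order_le_less)
qed

lemma ctmc_difference_quotient:
  assumes "is_ctmc r P"
  shows "x \<noteq> y \<Longrightarrow> ((\<lambda>t. pmf (P t x) y / t) \<longlongrightarrow> r x y) (at_right 0)"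
    and "((\<lambda>t. (1 - pmf (P t x) x) / t) \<longlongrightarrow> out_rate r x) (at_right 0)"
proof -
  have d: "((\<lambda>t. (pmf (P t x) y - pmf (P 0 x) y) / (t - 0)) \<longlongrightarrow> rate_matrix r x y) (at_right 0)" for y
    using assms unfolding is_ctmc_def has_field_derivative_iff by blast
  have P0: "P 0 x = return_pmf x" using assms by (simp add: is_ctmc_def)
  show "x \<noteq> y \<Longrightarrow> ((\<lambda>t. pmf (P t x) y / t) \<longlongrightarrow> r x y) (at_right 0)"
    using d[of y] by (simp add: P0 rate_matrix_def)
  show "((\<lambda>t. (1 - pmf (P t x) x) / t) \<longlongrightarrow> out_rate r x) (at_right 0)"
    using tendsto_minus[OF d[of x]] by (simp add: P0 rate_matrix_def minus_divide_left)
qed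

lemma LIMSEQ_div_Suc_at_right:
  fixes t :: real
  assumes "0 < t"
  shows "filterlim (\<lambda>k. t / Suc k) (at_right 0) sequentially"
proof -
  have "(\<lambda>k. t / Suc k) \<longlonglongrightarrow> 0" by (rule LIMSEQ_Suc[OF lim_const_over_n])
  then show ?thesis using assms
    by (auto simp: filterlim_at_right_to_0 filterlim_at intro!: always_eventually)
qed

text \<open>Fatou's lemma bounds the inflow into each state by the outflow; since the rates are
  bounded, both have the same finite total, so they agree in every state.\<close>

lemma stationary_imp_globally_balanced:
  fixes r :: "'s::countable \<Rightarrow> 's \<Rightarrow> real"
  assumes ctmc: "is_ctmc r P" and st: "stationary P p" and b: "\<And>x. out_rate r x \<le> C"
  shows "globally_balanced r p"
proof -
  have r: "is_rates r" using ctmc by (simp add: is_ctmc_def)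
  let ?h = "\<lambda>k. 1 / real (Suc k)"
  have h: "filterlim ?h (at_right 0) sequentially" by (rule LIMSEQ_div_Suc_at_right) simp
  define L where "L y = (\<integral>\<^sup>+x. ennreal (jump_rate r x y) \<partial>measure_pmf p)" for y
  define R where "R y = ennreal (pmf p y * out_rate r y)" for y
  have le: "L y \<le> R y" for y
  proof -
    \<comment> \<open>Off-diagonal difference quotients at time \<open>?h k\<close>; they converge
      to the jump rates into \<open>y\<close>. The entry at \<open>y\<close> itself is left out
      because its quotient diverges.\<close>
    define u where "u k x = ennreal (if x = y then 0 else pmf (P (?h k) x) y / ?h k)" for k x
    have lim: "(\<lambda>k. u k x) \<longlonglongrightarrow> ennreal (jump_rate r x y)" for x
    proof (cases "x = y")
      case False
      then show ?thesis
        unfolding u_def jump_rate_def using filterlim_compose[OF ctmc_difference_quotient(1)[OF ctmc False] h]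
        by (auto intro!: tendsto_ennrealI)
    qed (simp add: u_def jump_rate_def)
    \<comment> \<open>By stationarity the entries \<open>pmf (P (?h k) x) y\<close>, averaged over
      all \<open>x\<close>, give \<open>pmf p y\<close>. Taking away the finite contribution of
      \<open>x = y\<close> leaves the probability of having left \<open>y\<close>, divided by the
      time step.\<close>
    have int: "(\<integral>\<^sup>+x. u k x \<partial>p) = ennreal (pmf p y * ((1 - pmf (P (?h k) y) y) / ?h k))" for k
    proof -
      define d where "d = ?h k"
      have d: "0 < d" by (simp add: d_def)
      have eq: "u k x + ennreal (pmf (P d y) y / d) * indicator {y} x
          = ennreal (pmf (P d x) y) * ennreal (1 / d)" for x
        unfolding u_def d_def[symmetric] using d by (auto simp: ennreal_mult[symmetric])
      have "(\<integral>\<^sup>+x. u k x \<partial>p) + ennreal (pmf (P d y) y / d) * ennreal (pmf p y)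
        = (\<integral>\<^sup>+x. u k x + ennreal (pmf (P d y) y / d) * indicator {y} x \<partial>p)"
        by (subst nn_integral_add) (auto simp: nn_integral_cmult emeasure_pmf_single)
      also have "\<dots> = (\<integral>\<^sup>+x. pmf (P d x) y \<partial>p) * ennreal (1 / d)"
        unfolding eq by (simp add: nn_integral_multc)
      also have "\<dots> = ennreal (pmf p y / d)"
        using st by (subst ennreal_pmf_bind[symmetric]) (use d in \<open>simp add: stationary_def ennreal_mult[symmetric]\<close>)
      finally have "(\<integral>\<^sup>+x. u k x \<partial>p) + ennreal (pmf (P d y) y / d * pmf p y) = ennreal (pmf p y / d)"
        using d by (subst ennreal_mult) auto
      then have "(\<integral>\<^sup>+x. u k x \<partial>p) = ennreal (pmf p y / d) - ennreal (pmf (P d y) y / d * pmf p y)"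
        by (metis ennreal_add_diff_cancel_right ennreal_neq_top)
      also have "\<dots> = ennreal (pmf p y * ((1 - pmf (P d y) y) / d))"
        by (subst ennreal_minus) (use d in \<open>auto simp: field_simps\<close>)
      finally show ?thesis by (simp only: d_def)
    qed
    have "L y = (\<integral>\<^sup>+x. liminf (\<lambda>k. u k x) \<partial>p)"
      unfolding L_def by (intro nn_integral_cong lim_imp_Liminf[symmetric] lim) auto
    also have "\<dots> \<le> liminf (\<lambda>k. \<integral>\<^sup>+x. u k x \<partial>p)"
      by (intro nn_integral_liminf) auto
    also have "\<dots> = R y"
      unfolding int R_def
      by (intro lim_imp_Liminf tendsto_ennrealI tendsto_mult tendsto_const
          filterlim_compose[OF ctmc_difference_quotient(2)[OF ctmc] h]) auto
    finally show ?thesis .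
  qed
  have "(\<integral>\<^sup>+y. L y \<partial>count_space UNIV)
      = (\<integral>\<^sup>+x. \<integral>\<^sup>+y. ennreal (jump_rate r x y) \<partial>count_space UNIV \<partial>p)"
    unfolding L_def by (subst nn_integral_count_space_nn_integral) auto
  also have "\<dots> = (\<integral>\<^sup>+x. ennreal (out_rate r x) \<partial>p)"
    using r by (simp add: nn_integral_jump_rate)
  also have "\<dots> = (\<integral>\<^sup>+y. R y \<partial>count_space UNIV)"
    unfolding nn_integral_measure_pmf R_def by (simp add: ennreal_mult out_rate_nonneg[OF r])
  finally have eq: "(\<integral>\<^sup>+y. L y \<partial>count_space UNIV) = (\<integral>\<^sup>+y. R y \<partial>count_space UNIV)" .
  have "(\<integral>\<^sup>+x. ennreal (out_rate r x) \<partial>p) \<le> (\<integral>\<^sup>+x. ennreal C \<partial>p)"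
    by (intro nn_integral_mono ennreal_leI b)
  also have "\<dots> < \<infinity>" by simp
  finally have "(\<integral>\<^sup>+y. L y \<partial>count_space UNIV) < \<infinity>"
    using r \<open>_ = (\<integral>\<^sup>+x. ennreal (out_rate r x) \<partial>p)\<close>
      \<open>(\<integral>\<^sup>+y. L y \<partial>count_space UNIV) = (\<integral>\<^sup>+x. \<integral>\<^sup>+y. ennreal (jump_rate r x y) \<partial>count_space UNIV \<partial>p)\<close> by simp
  from nn_integral_eq_imp_eq[OF le eq this] show ?thesis
    by (simp add: globally_balanced_def L_def R_def)
qed

text \<open>Tonelli exchanges the sum over targets with the mean over sources; global balance then
  turns the inflow into each target into its outflow.\<close>

lemma globally_balanced_nn_integral:
  fixes r :: "'s::countable \<Rightarrow> 's \<Rightarrow> real"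
  assumes r: "is_rates r" and bal: "globally_balanced r p" and b: "\<And>x. out_rate r x \<le> C"
    and g: "integrable (measure_pmf p) g" "\<And>x. 0 \<le> g x"
    and K: "\<And>x. integrable (count_space UNIV) (\<lambda>y. jump_rate r x y * g y)"
  shows "has_bochner_integral (measure_pmf p) (\<lambda>x. \<integral>y. jump_rate r x y * g y \<partial>count_space UNIV)
           (\<integral>x. out_rate r x * g x \<partial>measure_pmf p)"
proof -
  have og: "integrable (measure_pmf p) (\<lambda>x. out_rate r x * g x)"
    by (rule Bochner_Integration.integrable_bound[where f = "\<lambda>x. C * g x"])
      (use g b out_rate_nonneg[OF r] in \<open>auto simp: abs_mult intro!: mult_right_mono order_trans[OF b]\<close>)
  have "(\<integral>\<^sup>+x. ennreal (\<integral>y. jump_rate r x y * g y \<partial>count_space UNIV) \<partial>p)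
      = (\<integral>\<^sup>+x. \<integral>\<^sup>+y. ennreal (jump_rate r x y * g y) \<partial>count_space UNIV \<partial>p)"
    using jump_rate_nonneg[OF r] g(2)
    by (intro nn_integral_cong nn_integral_eq_integral[symmetric] K) auto
  also have "\<dots> = (\<integral>\<^sup>+y. \<integral>\<^sup>+x. ennreal (jump_rate r x y) * ennreal (g y) \<partial>p \<partial>count_space UNIV)"
    using jump_rate_nonneg[OF r] g(2)
    by (subst nn_integral_count_space_nn_integral) (auto simp: ennreal_mult)
  also have "\<dots> = (\<integral>\<^sup>+y. ennreal (pmf p y * out_rate r y) * ennreal (g y) \<partial>count_space UNIV)"
    using bal by (simp add: nn_integral_multc globally_balanced_def)
  also have "\<dots> = (\<integral>\<^sup>+x. ennreal (out_rate r x * g x) \<partial>p)"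
    using g(2) out_rate_nonneg[OF r] by (simp add: nn_integral_measure_pmf ennreal_mult mult.assoc)
  also have "\<dots> = ennreal (\<integral>x. out_rate r x * g x \<partial>p)"
    using g(2) out_rate_nonneg[OF r] by (intro nn_integral_eq_integral og) auto
  finally show ?thesis
    using g(2) out_rate_nonneg[OF r] jump_rate_nonneg[OF r]
    by (intro has_bochner_integral_nn_integral) (auto intro!: integral_nonneg_AE)
qed

text \<open>Positive and negative parts of \<open>g\<close> are treated separately; the bound
  \<open>C\<close> keeps both outflow integrals finite, so the two identities can be subtracted.
  This form, saying that the generator has mean zero, admits the unbounded test functions built from
  \<open>V\<close>.\<close>

lemma globally_balanced_integral:
  fixes r :: "'s::countable \<Rightarrow> 's \<Rightarrow> real"
  assumes r: "is_rates r" and bal: "globally_balanced r p" and b: "\<And>x. out_rate r x \<le> C"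
    and g: "integrable (measure_pmf p) g"
    and K: "\<And>x. integrable (count_space UNIV) (\<lambda>y. jump_rate r x y * g y)"
  shows "has_bochner_integral (measure_pmf p) (\<lambda>x. \<integral>y. jump_rate r x y * g y \<partial>count_space UNIV)
           (\<integral>x. out_rate r x * g x \<partial>measure_pmf p)"
proof -
  let ?p = "\<lambda>x. max 0 (g x)" and ?n = "\<lambda>x. max 0 (- g x)"
  have gi: "integrable p ?p" "integrable p ?n" using g by auto
  have Ki: "integrable (count_space UNIV) (\<lambda>y. jump_rate r x y * ?p y)"
     "integrable (count_space UNIV) (\<lambda>y. jump_rate r x y * ?n y)" for x
    by (rule Bochner_Integration.integrable_bound[OF K[of x]];
        auto simp: abs_mult intro!: mult_left_mono)+
  have oi: "integrable (measure_pmf p) (\<lambda>x. out_rate r x * ?p x)"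
     "integrable (measure_pmf p) (\<lambda>x. out_rate r x * ?n x)"
    by (rule Bochner_Integration.integrable_bound[where f = "\<lambda>x. C * ?p x"]
        Bochner_Integration.integrable_bound[where f = "\<lambda>x. C * ?n x"];
        use gi b out_rate_nonneg[OF r] in \<open>auto simp: abs_mult intro!: mult_right_mono order_trans[OF b]\<close>)+
  have "has_bochner_integral p (\<lambda>x. (\<integral>y. jump_rate r x y * ?p y \<partial>count_space UNIV)
          - (\<integral>y. jump_rate r x y * ?n y \<partial>count_space UNIV))
       ((\<integral>x. out_rate r x * ?p x \<partial>p) - (\<integral>x. out_rate r x * ?n x \<partial>p))"
    by (intro has_bochner_integral_diff globally_balanced_nn_integral[OF r bal b] gi Ki) auto
  also have "(\<lambda>x. (\<integral>y. jump_rate r x y * ?p y \<partial>count_space UNIV)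
          - (\<integral>y. jump_rate r x y * ?n y \<partial>count_space UNIV))
      = (\<lambda>x. \<integral>y. jump_rate r x y * g y \<partial>count_space UNIV)"
    by (subst Bochner_Integration.integral_diff[symmetric, OF Ki])
      (auto intro!: Bochner_Integration.integral_cong simp: right_diff_distrib[symmetric] max_def)
  also have "(\<integral>x. out_rate r x * ?p x \<partial>p) - (\<integral>x. out_rate r x * ?n x \<partial>p) = (\<integral>x. out_rate r x * g x \<partial>p)"
    by (subst Bochner_Integration.integral_diff[symmetric, OF oi])
      (auto intro!: Bochner_Integration.integral_cong simp: right_diff_distrib[symmetric] max_def)
  finally show ?thesis .
qed

section \<open>Uniqueness of the balanced distribution\<close>

lemma pmf_bind_ge: "pmf p x * pmf (f x) y \<le> pmf (bind_pmf p f) y"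
proof -
  have "ennreal (pmf p x * pmf (f x) y) = (\<integral>\<^sup>+z. ennreal (pmf (f x) y) * indicator {x} z \<partial>p)"
    by (simp add: nn_integral_cmult emeasure_pmf_single ennreal_mult mult.commute)
  also have "\<dots> \<le> (\<integral>\<^sup>+z. pmf (f z) y \<partial>p)"
    by (intro nn_integral_mono) (auto simp: indicator_def)
  finally show ?thesis by (simp flip: ennreal_pmf_bind)
qed

text \<open>Being at \<open>x\<close> at every multiple of \<open>t / Suc k\<close> is one way of
  being there at time \<open>t\<close>. Bernoulli's inequality linearises the resulting power, and
  \<open>k\<close> tending to infinity produces the rate.\<close>

lemma ctmc_leaving_bound:
  assumes "is_ctmc r P" "0 \<le> t"
  shows "1 - pmf (P t x) x \<le> out_rate r x * t"
proof (cases "t = 0")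
  case True
  then show ?thesis using assms by (simp add: is_ctmc_def)
next
  case False
  then have t: "0 < t" using assms by simp
  have pow: "pmf (P h x) x ^ n \<le> pmf (P (real n * h) x) x" if "0 \<le> h" for n h
  proof (induction n)
    case 0
    then show ?case using assms by (simp add: is_ctmc_def)
  next
    case (Suc n)
    have "pmf (P h x) x ^ Suc n \<le> pmf (P h x) x * pmf (P (real n * h) x) x"
      using Suc by (simp add: mult_left_mono)
    also have "\<dots> \<le> pmf (bind_pmf (P h x) (P (real n * h))) x"
      by (rule pmf_bind_ge)
    also have "bind_pmf (P h x) (P (real n * h)) = P (real (Suc n) * h) x"
      using assms(1) that by (simp add: is_ctmc_def algebra_simps)
    finally show ?case .
  qed
  have "1 - pmf (P t x) x \<le> (1 - pmf (P (t / Suc k) x) x) / (t / Suc k) * t" for k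
  proof -
    let ?a = "pmf (P (t / Suc k) x) x"
    have "1 + real (Suc k) * (?a - 1) \<le> (1 + (?a - 1)) ^ Suc k"
      by (rule Bernoulli_inequality) simp
    also have "\<dots> \<le> pmf (P (real (Suc k) * (t / Suc k)) x) x"
      using pow[of "t / Suc k" "Suc k"] t by simp
    also have "real (Suc k) * (t / Suc k) = t" by simp
    finally have "1 - pmf (P t x) x \<le> real (Suc k) * (1 - ?a)" by (simp add: algebra_simps)
    also have "\<dots> = (1 - ?a) / (t / Suc k) * t" using t by simp
    finally show ?thesis .
  qed
  moreover have "(\<lambda>k. (1 - pmf (P (t / Suc k) x) x) / (t / Suc k) * t) \<longlonglongrightarrow> out_rate r x * t"
    by (intro tendsto_mult tendsto_const
        filterlim_compose[OF ctmc_difference_quotient(2)[OF assms(1)] LIMSEQ_div_Suc_at_right[OF t]])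
  ultimately show ?thesis by (intro LIMSEQ_le_const) auto
qed

text \<open>With outgoing rate zero the leaving bound keeps the chain at \<open>x\<close> with
  probability one at all times, so no mass is left to reach \<open>y\<close>.\<close>

lemma irreducible_out_rate_pos:
  assumes "is_ctmc r P" "irreducible_chain P" "x \<noteq> y"
  shows "0 < out_rate r x"
proof (rule ccontr)
  assume "\<not> 0 < out_rate r x"
  then have q: "out_rate r x = 0"
    using out_rate_nonneg[of r x] assms(1) by (auto simp: is_ctmc_def)
  obtain t where t: "0 \<le> t" "0 < pmf (P t x) y"
    using assms(2) by (auto simp: irreducible_chain_def)
  have "1 \<le> pmf (P t x) x" using ctmc_leaving_bound[OF assms(1) t(1), of x] q by simp
  moreover have "pmf (P t x) x + pmf (P t x) y = measure (P t x) {x, y}"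
    using assms(3) by (subst measure_measure_pmf_finite) auto
  moreover have "\<dots> \<le> 1" by simp
  ultimately show False using t by linarith
qed

text \<open>The stationary probability \<open>\<Phi> t\<close> of being in \<open>S\<close> at time \<open>0\<close> and outside \<open>S\<close> at time \<open>t\<close>
  is subadditive in \<open>t\<close>, and \<open>\<Phi> h = o(h)\<close> since no rate leads out of \<open>S\<close>.\<close>

lemma stationary_closed_set:
  fixes r :: "'s::countable \<Rightarrow> 's \<Rightarrow> real"
  assumes ctmc: "is_ctmc r P" and st: "stationary P p" and b: "\<And>x. out_rate r x \<le> C"
    and closed: "\<And>x y. x \<in> S \<Longrightarrow> y \<notin> S \<Longrightarrow> r x y = 0"
    and x: "x \<in> S" "0 < pmf p x" and y: "y \<notin> S" and t: "0 \<le> t"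
  shows "pmf (P t x) y = 0"
proof (cases "t = 0")
  case True
  then show ?thesis using ctmc x y by (auto simp: is_ctmc_def indicator_def)
next
  case False
  then have t: "0 < t" using t by simp
  have r: "is_rates r" using ctmc by (simp add: is_ctmc_def)
  have semi: "P (s + t) z = bind_pmf (P s z) (P t)" if "0 \<le> s" "0 \<le> t" for s t z
    using ctmc that by (simp add: is_ctmc_def)
  define \<Phi> where "\<Phi> t = (\<integral>\<^sup>+x. indicator S x * emeasure (P t x) (- S) \<partial>p)" for t
  \<comment> \<open>A chain in \<open>S\<close> at time 0 and outside at \<open>s + t\<close> is
    either outside at time \<open>s\<close>, or is in \<open>S\<close> at time \<open>s\<close> and
    outside after a further \<open>t\<close>. Stationarity restarts the second case at time
    \<open>s\<close>.\<close>
  have add: "\<Phi> (s + t) \<le> \<Phi> s + \<Phi> t" if "0 \<le> s" "0 \<le> t" for s t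
  proof -
    have "\<Phi> (s + t) = (\<integral>\<^sup>+x. indicator S x * (\<integral>\<^sup>+z. emeasure (P t z) (- S) \<partial>P s x) \<partial>p)"
      unfolding \<Phi>_def using that by (simp add: semi)
    also have "\<dots> \<le> (\<integral>\<^sup>+x. indicator S x *
          (\<integral>\<^sup>+z. indicator (- S) z + indicator S z * emeasure (P t z) (- S) \<partial>P s x) \<partial>p)"
      by (intro nn_integral_mono mult_left_mono)
        (auto simp: indicator_def measure_pmf.emeasure_le_1)
    also have "\<dots> = (\<integral>\<^sup>+x. indicator S x * emeasure (P s x) (- S)
          + indicator S x * (\<integral>\<^sup>+z. indicator S z * emeasure (P t z) (- S) \<partial>P s x) \<partial>p)"
      by (simp add: nn_integral_add distrib_left)
    also have "\<dots> = \<Phi> s + (\<integral>\<^sup>+x. indicator S x * (\<integral>\<^sup>+z. indicator S z * emeasure (P t z) (- S) \<partial>P s x) \<partial>p)"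
      by (simp add: nn_integral_add \<Phi>_def)
    also have "\<dots> \<le> \<Phi> s + (\<integral>\<^sup>+x. (\<integral>\<^sup>+z. indicator S z * emeasure (P t z) (- S) \<partial>P s x) \<partial>p)"
      by (intro add_left_mono nn_integral_mono) (auto simp: indicator_def)
    also have "\<dots> = \<Phi> s + (\<integral>\<^sup>+z. indicator S z * emeasure (P t z) (- S) \<partial>bind_pmf p (P s))"
      by (simp only: nn_integral_bind_pmf)
    also have "bind_pmf p (P s) = p" using st that by (simp add: stationary_def)
    finally show ?thesis by (simp add: \<Phi>_def)
  qed
  have mult: "\<Phi> (real (Suc k) * h) \<le> of_nat (Suc k) * \<Phi> h" if "0 \<le> h" for k h
  proof (induction k)
    case (Suc k)
    have "\<Phi> (real (Suc (Suc k)) * h) = \<Phi> (real (Suc k) * h + h)" by (simp add: algebra_simps)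
    also have "\<dots> \<le> \<Phi> (real (Suc k) * h) + \<Phi> h" using that by (intro add) auto
    also have "\<dots> \<le> of_nat (Suc k) * \<Phi> h + \<Phi> h" by (intro add_right_mono Suc)
    finally show ?case by (simp add: algebra_simps)
  qed simp
  define B where "B = (\<integral>\<^sup>+x. indicator S x * ennreal (out_rate r x) \<partial>p)"
  have "B \<le> (\<integral>\<^sup>+x. ennreal C \<partial>p)"
    unfolding B_def by (intro nn_integral_mono) (auto simp: indicator_def intro!: ennreal_leI b)
  also have "\<dots> < \<infinity>" by simp
  finally have B: "B < \<infinity>" .
  \<comment> \<open>Probability of starting in \<open>S\<close> and standing at a different state of
    \<open>S\<close> at time \<open>h\<close>. Together with \<open>\<Phi> h\<close> it is the
    probability of starting in \<open>S\<close> and being away from the starting point, which the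
    leaving bound controls.\<close>
  define A where "A h = (\<integral>\<^sup>+x. indicator S x * emeasure (P h x) (S - {x}) \<partial>p)" for h
  have upper: "\<Phi> h + A h \<le> ennreal h * B" if "0 \<le> h" for h
  proof -
    have "\<Phi> h + A h = (\<integral>\<^sup>+x. indicator S x * (emeasure (P h x) (- S) + emeasure (P h x) (S - {x})) \<partial>p)"
      by (simp add: \<Phi>_def A_def nn_integral_add distrib_left)
    also have "\<dots> \<le> (\<integral>\<^sup>+x. ennreal h * (indicator S x * ennreal (out_rate r x)) \<partial>p)"
    proof (intro nn_integral_mono)
      fix x
      have "emeasure (P h x) (- S) + emeasure (P h x) (S - {x}) \<le> ennreal h * ennreal (out_rate r x)" if "x \<in> S"
      proof -
        have "emeasure (P h x) (- S) + emeasure (P h x) (S - {x}) = emeasure (P h x) (- S \<union> (S - {x}))"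
          by (rule plus_emeasure) auto
        also have "- S \<union> (S - {x}) = UNIV - {x}" using \<open>x \<in> S\<close> by auto
        also have "emeasure (P h x) (UNIV - {x}) = ennreal (1 - pmf (P h x) x)"
          using measure_pmf.prob_compl[of "{x}" "P h x"]
          by (simp add: measure_pmf.emeasure_eq_measure measure_pmf_single)
        also have "\<dots> \<le> ennreal (h * out_rate r x)"
          using ctmc_leaving_bound[OF ctmc \<open>0 \<le> h\<close>, of x] by (intro ennreal_leI) (simp add: mult.commute)
        finally show ?thesis using \<open>0 \<le> h\<close> out_rate_nonneg[OF r] by (simp add: ennreal_mult)
      qed
      then show "indicator S x * (emeasure (P h x) (- S) + emeasure (P h x) (S - {x}))
          \<le> ennreal h * (indicator S x * ennreal (out_rate r x))"
        by (auto simp: indicator_def)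
    qed
    also have "\<dots> = ennreal h * B" by (simp add: B_def nn_integral_cmult)
    finally show ?thesis .
  qed
  let ?h = "\<lambda>k. t / Suc k"
  have h: "filterlim ?h (at_right 0) sequentially" by (rule LIMSEQ_div_Suc_at_right[OF t])
  have "\<Phi> t + of_nat (Suc k) * A (?h k) \<le> ennreal t * B" for k
  proof -
    have "\<Phi> t \<le> of_nat (Suc k) * \<Phi> (?h k)"
      using mult[of "?h k" k] t by simp
    then have "\<Phi> t + of_nat (Suc k) * A (?h k) \<le> of_nat (Suc k) * (\<Phi> (?h k) + A (?h k))"
      by (simp only: distrib_left add_right_mono)
    also have "\<dots> \<le> of_nat (Suc k) * (ennreal (?h k) * B)"
      using t by (intro mult_left_mono upper) auto
    also have "\<dots> = ennreal (real (Suc k) * ?h k) * B"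
      unfolding ennreal_of_nat_eq_real_of_nat mult.assoc[symmetric] using t by (subst ennreal_mult) auto
    finally show ?thesis by simp
  qed
  then have "of_nat (Suc k) * A (?h k) \<le> ennreal t * B - \<Phi> t" for k
    by (metis add.commute ennreal_le_minus_iff)
  then have "liminf (\<lambda>k. of_nat (Suc k) * A (?h k)) \<le> liminf (\<lambda>k::nat. ennreal t * B - \<Phi> t)"
    by (intro Liminf_mono always_eventually allI)
  then have 1: "liminf (\<lambda>k. of_nat (Suc k) * A (?h k)) \<le> ennreal t * B - \<Phi> t"
    by (simp add: Liminf_const)
  \<comment> \<open>Fatou over the target state. Since no rate leads out of \<open>S\<close>, jumps
    within \<open>S\<close> already carry the whole outgoing rate of \<open>x\<close>.\<close>
  have inner: "ennreal t * ennreal (out_rate r x)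
      \<le> liminf (\<lambda>k. of_nat (Suc k) * emeasure (P (?h k) x) (S - {x}))" if "x \<in> S" for x
  proof -
    define u where "u k y = indicator (S - {x}) y * ennreal (t * (pmf (P (?h k) x) y / ?h k))" for k y
    have intu: "(\<integral>\<^sup>+y. u k y \<partial>count_space UNIV) = of_nat (Suc k) * emeasure (P (?h k) x) (S - {x})" for k
    proof -
      have "u k y = of_nat (Suc k) * (ennreal (pmf (P (?h k) x) y) * indicator (S - {x}) y)" for y
        unfolding u_def ennreal_of_nat_eq_real_of_nat using t
        by (auto simp: indicator_def ennreal_mult[symmetric] mult.commute simp del: of_nat_Suc)
      then show ?thesis
        by (simp add: nn_integral_cmult nn_integral_measure_pmf[symmetric])
    qed
    have "ennreal t * ennreal (out_rate r x) = (\<integral>\<^sup>+y. ennreal t * jump_rate r x y \<partial>count_space UNIV)"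
      by (simp add: nn_integral_cmult nn_integral_jump_rate[OF r])
    also have "\<dots> = (\<integral>\<^sup>+y. liminf (\<lambda>k. u k y) \<partial>count_space UNIV)"
    proof (intro nn_integral_cong lim_imp_Liminf[symmetric])
      fix y
      show "(\<lambda>k. u k y) \<longlonglongrightarrow> ennreal t * ennreal (jump_rate r x y)"
      proof (cases "y \<in> S - {x}")
        case True
        then have "(\<lambda>k. t * (pmf (P (?h k) x) y / ?h k)) \<longlonglongrightarrow> t * r x y"
          by (intro tendsto_mult tendsto_const filterlim_compose[OF ctmc_difference_quotient(1)[OF ctmc] h]) auto
        then show ?thesis unfolding u_def using True t jump_rate_nonneg[OF r, of x y]
          by (auto simp: jump_rate_def ennreal_mult[symmetric] intro!: tendsto_ennrealI)
      qed (use closed[OF \<open>x \<in> S\<close>] in \<open>auto simp: u_def jump_rate_def\<close>)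
    qed simp
    also have "\<dots> \<le> liminf (\<lambda>k. \<integral>\<^sup>+y. u k y \<partial>count_space UNIV)"
      by (intro nn_integral_liminf) auto
    finally show ?thesis unfolding intu .
  qed
  have "ennreal t * B = (\<integral>\<^sup>+x. indicator S x * (ennreal t * ennreal (out_rate r x)) \<partial>p)"
    unfolding B_def by (subst nn_integral_cmult[symmetric]) (auto intro!: nn_integral_cong simp: indicator_def)
  also have "\<dots> \<le> (\<integral>\<^sup>+x. liminf (\<lambda>k. of_nat (Suc k) * (indicator S x * emeasure (P (?h k) x) (S - {x}))) \<partial>p)"
    using inner by (intro nn_integral_mono) (simp add: indicator_def)
  also have "\<dots> \<le> liminf (\<lambda>k. \<integral>\<^sup>+x. of_nat (Suc k) * (indicator S x * emeasure (P (?h k) x) (S - {x})) \<partial>p)"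
    by (intro nn_integral_liminf) auto
  also have "\<dots> = liminf (\<lambda>k. of_nat (Suc k) * A (?h k))"
    unfolding A_def by (simp add: nn_integral_cmult del: of_nat_Suc)
  \<comment> \<open>Fatou over the starting state shows that jumps within \<open>S\<close> alone
    exhaust the budget \<open>ennreal t * B\<close>. As the budget is finite, nothing remains for
    \<open>\<Phi> t\<close>.\<close>
  finally have 2: "ennreal t * B \<le> ennreal t * B - \<Phi> t" using 1 by order
  have "\<Phi> t \<le> ennreal t * B" using order_trans[OF le_iff_add[THEN iffD2] upper[of t]] t by force
  moreover have "ennreal t * B < \<infinity>" using B by (simp add: ennreal_mult_less_top)
  ultimately have "\<Phi> t = 0" using 2
    by (cases "\<Phi> t"; cases "ennreal t * B") (auto simp: ennreal_minus)
  then have "AE x in p. indicator S x * emeasure (P t x) (- S) = 0"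
    unfolding \<Phi>_def by (subst (asm) nn_integral_0_iff_AE) auto
  then have "emeasure (P t x) (- S) = 0"
    using x by (simp add: AE_measure_pmf_iff) (metis indicator_eq_1_iff less_irrefl set_pmf_iff zero_neq_one)
  then have "y \<notin> set_pmf (P t x)" using y
    using emeasure_mono[of "{y}" "- S" "measure_pmf (P t x)"]
    by (auto simp: emeasure_pmf_single set_pmf_iff)
  then show ?thesis by (simp add: set_pmf_iff)
qed

text \<open>Comparing the balance of \<open>S = {x. pmf p' x < pmf p x}\<close> under \<open>p\<close> and \<open>p'\<close> shows that no rate
  leads out of \<open>S\<close>.\<close>

lemma globally_balanced_unique:
  fixes r :: "'s::countable \<Rightarrow> 's \<Rightarrow> real"
  assumes ctmc: "is_ctmc r P" and irr: "irreducible_chain P" and st: "stationary P p"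
    and b: "\<And>x. out_rate r x \<le> C" and bal: "globally_balanced r p'"
  shows "p' = p"
proof (rule ccontr)
  assume ne: "p' \<noteq> p"
  have r: "is_rates r" using ctmc by (simp add: is_ctmc_def)
  define S where "S = {x. pmf p' x < pmf p x}"
  obtain x0 where x0: "x0 \<in> S" using pmf_neq_exists_less[OF ne] by (auto simp: S_def)
  obtain y0 where "pmf p y0 < pmf p' y0" using pmf_neq_exists_less[OF ne[symmetric]] by blast
  then have y0: "y0 \<notin> S" by (simp add: S_def)
  let ?g = "indicator S :: 's \<Rightarrow> real"
  have Ki: "integrable (count_space UNIV) (\<lambda>y. jump_rate r x y * ?g y)" for x
    by (rule Bochner_Integration.integrable_bound[OF integrable_jump_rate(1)[OF r, of x]])
      (auto simp: indicator_def)
  \<comment> \<open>The generator applied to the indicator of \<open>S\<close>; its mean is zero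
    under every balanced distribution, hence under both \<open>p\<close> and
    \<open>p'\<close>.\<close>
  define \<psi> where "\<psi> x = (\<integral>y. jump_rate r x y * ?g y \<partial>count_space UNIV) - out_rate r x * ?g x" for x
  have hb: "has_bochner_integral (count_space UNIV) (\<lambda>x. pmf m x * \<psi> x) 0" if m: "globally_balanced r m" for m
  proof -
    have gi: "integrable m ?g" by (rule measure_pmf.integrable_const_bound[where B=1]) auto
    have oi: "integrable m (\<lambda>x. out_rate r x * ?g x)"
      by (rule measure_pmf.integrable_const_bound[where B=C])
        (use b out_rate_nonneg[OF r] order_trans[OF out_rate_nonneg[OF r] b] in \<open>auto simp: indicator_def\<close>)
    have "has_bochner_integral m \<psi> 0"
      using has_bochner_integral_diff[OF globally_balanced_integral[OF r m b gi Ki] has_bochner_integral_integrable[OF oi]]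
      by (simp add: \<psi>_def[abs_def])
    then show ?thesis
      unfolding measure_pmf_eq_density has_bochner_integral_iff
      by (auto simp: integrable_density integral_density)
  qed
  have "has_bochner_integral (count_space UNIV) (\<lambda>x. pmf p' x * \<psi> x - pmf p x * \<psi> x) (0 - 0)"
    by (intro has_bochner_integral_diff hb bal stationary_imp_globally_balanced[OF ctmc st b])
  then have D: "has_bochner_integral (count_space UNIV) (\<lambda>x. (pmf p' x - pmf p x) * \<psi> x) 0"
    by (simp add: algebra_simps)
  have \<psi>S: "\<psi> x = - (\<integral>y. jump_rate r x y * indicator (- S) y \<partial>count_space UNIV)" if "x \<in> S" for x
  proof -
    have "\<psi> x = (\<integral>y. jump_rate r x y * ?g y \<partial>count_space UNIV) - (\<integral>y. jump_rate r x y \<partial>count_space UNIV)"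
      using that by (simp add: \<psi>_def integrable_jump_rate[OF r])
    also have "\<dots> = (\<integral>y. jump_rate r x y * ?g y - jump_rate r x y \<partial>count_space UNIV)"
      by (intro Bochner_Integration.integral_diff[symmetric] Ki integrable_jump_rate[OF r])
    also have "\<dots> = (\<integral>y. - (jump_rate r x y * indicator (- S) y) \<partial>count_space UNIV)"
      by (intro Bochner_Integration.integral_cong) (auto simp: indicator_def)
    finally show ?thesis by simp
  qed
  \<comment> \<open>On \<open>S\<close> both factors are nonpositive, since \<open>\<psi>\<close> is
    minus the rate of leaving \<open>S\<close>; off \<open>S\<close> both are nonnegative, since
    \<open>\<psi>\<close> is the rate of entering \<open>S\<close>. With total zero, every product
    vanishes.\<close>
  have nonneg: "0 \<le> (pmf p' x - pmf p x) * \<psi> x" for x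
  proof (cases "x \<in> S")
    case True
    then show ?thesis using jump_rate_nonneg[OF r]
      by (intro mult_nonpos_nonpos) (auto simp: \<psi>S S_def intro!: integral_nonneg_AE)
  next
    case False
    then show ?thesis using jump_rate_nonneg[OF r]
      by (intro mult_nonneg_nonneg) (auto simp: \<psi>_def S_def intro!: integral_nonneg_AE)
  qed
  have "(pmf p' x - pmf p x) * \<psi> x = 0" for x
    using integral_nonneg_eq_0_iff_AE[OF has_bochner_integral_iff[THEN iffD1, OF D, THEN conjunct1]]
      D nonneg by (auto simp: has_bochner_integral_iff AE_count_space)
  then have \<psi>0: "\<psi> x = 0" if "x \<in> S" for x
    using that by (auto simp: S_def) (metis less_irrefl)
  have closed: "r x y = 0" if "x \<in> S" "y \<notin> S" for x y
  proof -
    have i: "integrable (count_space UNIV) (\<lambda>y. jump_rate r x y * indicator (- S) y)"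
      by (rule Bochner_Integration.integrable_bound[OF integrable_jump_rate(1)[OF r, of x]])
        (auto simp: indicator_def)
    have "(\<integral>y. jump_rate r x y * indicator (- S) y \<partial>count_space UNIV) = 0"
      using \<psi>S \<psi>0 that by simp
    then have "jump_rate r x y * indicator (- S) y = 0"
      using integral_nonneg_eq_0_iff_AE[OF i] jump_rate_nonneg[OF r] by (auto simp: AE_count_space)
    then show ?thesis using that by (auto simp: jump_rate_def split: if_splits)
  qed
  obtain t where t: "0 \<le> t" "0 < pmf (P t x0) y0"
    using irr by (auto simp: irreducible_chain_def)
  have "0 < pmf p x0" using x0 by (auto simp: S_def intro: le_less_trans[OF pmf_nonneg])
  from stationary_closed_set[OF ctmc st b closed x0 this y0 t(1)] t(2) show False by simp
qed

section \<open>Moments, truncation and the Poisson equation in rate form\<close>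

lemma integrable_of_powr_moment:
  fixes V :: "'a \<Rightarrow> real"
  assumes "integrable (measure_pmf p) (\<lambda>i. \<bar>V i\<bar> powr (1 + \<xi>))" "0 < \<xi>"
  shows "integrable (measure_pmf p) V"
proof (rule Bochner_Integration.integrable_bound[where f = "\<lambda>i. 1 + \<bar>V i\<bar> powr (1 + \<xi>)"])
  have "\<bar>V i\<bar> \<le> 1 + \<bar>V i\<bar> powr (1 + \<xi>)" for i
  proof (cases "\<bar>V i\<bar> \<le> 1")
    case True
    then show ?thesis using powr_ge_zero[of "\<bar>V i\<bar>" "1 + \<xi>"] by linarith
  next
    case False
    then have "\<bar>V i\<bar> powr 1 \<le> \<bar>V i\<bar> powr (1 + \<xi>)"
      using assms(2) by (intro powr_mono) auto
    then show ?thesis using False by simp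
  qed
  then show "AE i in p. norm (V i) \<le> norm (1 + \<bar>V i\<bar> powr (1 + \<xi>))"
    by (intro AE_I2) (simp add: order_trans[OF _ abs_ge_self])
qed (use assms in auto)

text \<open>This truncation takes the place of Hoelder's inequality.\<close>

lemma le_add_powr_truncation:
  fixes v K \<xi> :: real
  assumes "0 \<le> v" "0 < K" "0 < \<xi>"
  shows "v \<le> K + K powr (- \<xi>) * v powr (1 + \<xi>)"
proof (cases "v \<le> K")
  case True
  then show ?thesis using assms by (simp add: add_increasing2)
next
  case False
  then have v: "0 < v" "K \<le> v" using assms by auto
  have "1 = K powr (- \<xi>) * K powr \<xi>" using assms by (simp add: powr_add[symmetric])
  also have "\<dots> \<le> K powr (- \<xi>) * v powr \<xi>"
    using assms v by (intro mult_left_mono powr_mono2) auto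
  finally have "v * 1 \<le> v * (K powr (- \<xi>) * v powr \<xi>)"
    using v by (intro mult_left_mono) auto
  then have "v \<le> K powr (- \<xi>) * v powr (1 + \<xi>)" using v by (simp add: powr_add mult_ac)
  then show ?thesis using assms by linarith
qed

text \<open>Multiplying the Poisson equation by the outgoing rate, which irreducibility makes
  positive once there is a second state, gives the form in which the generator acts on
  \<open>V\<close>.\<close>

lemma poisson_has_sum:
  fixes \<alpha> :: "'z \<Rightarrow> 'z \<Rightarrow> real"
  assumes ctmc: "is_ctmc \<alpha> PZ" and irr: "irreducible_chain PZ" and V: "poisson_solution \<alpha> \<pi> f V"
  shows "((\<lambda>i'. \<alpha> i i' * V i') has_sum
           (out_rate \<alpha> i * V i - (f i - measure_pmf.expectation \<pi> f))) (- {i})"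
proof (cases "\<exists>k. k \<noteq> i")
  case True
  then have q: "0 < out_rate \<alpha> i" using irreducible_out_rate_pos[OF ctmc irr] by metis
  let ?q = "out_rate \<alpha> i" and ?S = "infsum (\<lambda>i'. \<alpha> i i' / out_rate \<alpha> i * V i') (- {i})"
  have "(\<lambda>i'. \<alpha> i i' / ?q * V i') summable_on (- {i})"
    and Vi: "V i = (f i - measure_pmf.expectation \<pi> f) / ?q + ?S"
    using V unfolding poisson_solution_def by blast+
  then have "((\<lambda>i'. \<alpha> i i' / ?q * V i') has_sum ?S) (- {i})"
    by (intro has_sum_infsum)
  from has_sum_cmult_right[OF this, of ?q]
  have qS: "((\<lambda>i'. \<alpha> i i' * V i') has_sum (?q * ?S)) (- {i})" using q by simp
  have "?S = V i - (f i - measure_pmf.expectation \<pi> f) / ?q" using Vi by linarith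
  then have "?q * ?S = ?q * (V i - (f i - measure_pmf.expectation \<pi> f) / ?q)" by (rule arg_cong)
  also have "\<dots> = ?q * V i - ?q * ((f i - measure_pmf.expectation \<pi> f) / ?q)" by (rule right_diff_distrib)
  also have "?q * ((f i - measure_pmf.expectation \<pi> f) / ?q) = f i - measure_pmf.expectation \<pi> f"
    using q by (intro nonzero_mult_div_cancel_left[of ?q, unfolded times_divide_eq_right[symmetric]]) simp
  finally show ?thesis using qS by simp
\<comment> \<open>With a single state the outgoing rate is zero and the division in the Poisson
  equation degenerates, but \<open>f\<close> then equals its mean and both sides are zero.\<close>
next
  case False
  have "measure_pmf.expectation \<pi> f = measure_pmf.expectation \<pi> (\<lambda>_. f i)"
    using False by (intro Bochner_Integration.integral_cong) metis+
  then have "measure_pmf.expectation \<pi> f = f i" by simp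
  moreover have "- {i} = {}" using False by blast
  ultimately show ?thesis by (simp add: out_rate_def)
qed

section \<open>The stationary JSQ system\<close>

lemma has_sum_single_point:
  assumes "p \<in> A"
  shows "((\<lambda>y. if y = p then f y else 0) has_sum f p) A"
  using assms has_sum_finite[of "{p}" f]
  by (subst has_sum_cong_neutral[where T = "{p}" and g = f]) auto

lemma has_sum_sum_family:
  fixes f :: "'j \<Rightarrow> 'a \<Rightarrow> 'b::topological_comm_monoid_add"
  assumes "finite J" "\<And>j. j \<in> J \<Longrightarrow> (f j has_sum S j) A"
  shows "((\<lambda>y. \<Sum>j\<in>J. f j y) has_sum (\<Sum>j\<in>J. S j)) A"
  using assms by (induction J rule: finite_induct) (auto intro!: has_sum_add)

definition busy_rate :: "('z \<Rightarrow> 'n::finite \<Rightarrow> real) \<Rightarrow> 'z \<Rightarrow> 'n queues \<Rightarrow> real" where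
  "busy_rate \<mu> i q = (\<Sum>j | 0 < q $ j. \<mu> i j)"

lemma shortest_nonempty: "shortest q \<noteq> {}"
proof -
  obtain j where "\<forall>k. q $ j \<le> q $ k"
    using ex_has_least_nat[of "\<lambda>_. True" _ "\<lambda>j. q $ j"] by auto
  then show ?thesis by (auto simp: shortest_def)
qed

lemma total_queue_add_job: "total_queue (add_job j q) = total_queue q + 1"
proof -
  have "(\<Sum>k\<in>UNIV. add_job j q $ k) = (\<Sum>k\<in>UNIV. q $ k + (if k = j then 1 else 0))"
    by (intro sum.cong) (auto simp: add_job_def)
  then show ?thesis by (simp add: total_queue_def sum.distrib)
qed

lemma total_queue_remove_job:
  assumes "0 < q $ j"
  shows "total_queue (remove_job j q) = total_queue q - 1"
proof -
  have "add_job j (remove_job j q) = q"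
    using assms by (auto simp: add_job_def remove_job_def vec_eq_iff)
  then show ?thesis using total_queue_add_job[of j "remove_job j q"] by simp
qed

lemma total_queue_nonneg: "0 \<le> total_queue q"
  unfolding total_queue_def by (rule of_nat_0_le_iff)

text \<open>Arrivals and departures contribute finitely many point targets; changes of the
  modulating state are reindexed along \<open>(i', q)\<close>. Arrivals and departures change the
  total queue length, so excluding the target \<open>(i, q)\<close> loses none of them.\<close>

lemma has_sum_jsq_rates:
  fixes g :: "'z \<times> 'n::finite queues \<Rightarrow> real"
  assumes "((\<lambda>i'. \<alpha> i i' * g (i', q)) has_sum T) (- {i})"
  shows "((\<lambda>y. jsq_rates \<alpha> l \<mu> (i, q) y * g y) has_sum
     ((\<Sum>j\<in>shortest q. l i / real (card (shortest q)) * g (i, add_job j q))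
      + (\<Sum>j | 0 < q $ j. \<mu> i j * g (i, remove_job j q)) + T)) (- {(i, q)})"
proof -
  have ne: "add_job j q \<noteq> q" for j
    using total_queue_add_job[of j q] by auto
  have ne': "remove_job j q \<noteq> q" if "0 < q $ j" for j
    using total_queue_remove_job[OF that] by auto
  let ?c = "l i / real (card (shortest q))"
  let ?F1 = "\<lambda>y. \<Sum>j\<in>shortest q. if y = (i, add_job j q) then ?c * g y else 0"
  let ?F2 = "\<lambda>y. \<Sum>j | 0 < q $ j. if y = (i, remove_job j q) then \<mu> i j * g y else 0"
  let ?F3 = "\<lambda>y. if snd y = q then \<alpha> i (fst y) * g y else 0"
  have 1: "(?F1 has_sum (\<Sum>j\<in>shortest q. ?c * g (i, add_job j q))) (- {(i, q)})"
    using ne by (intro has_sum_sum_family has_sum_single_point) auto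
  have 2: "(?F2 has_sum (\<Sum>j | 0 < q $ j. \<mu> i j * g (i, remove_job j q))) (- {(i, q)})"
    using ne' by (intro has_sum_sum_family has_sum_single_point) auto
  have "((\<lambda>y. \<alpha> i (fst y) * g y) has_sum T) ((\<lambda>i'. (i', q)) ` (- {i}))"
    using assms by (subst has_sum_reindex) (auto simp: inj_on_def o_def)
  then have 3: "(?F3 has_sum T) (- {(i, q)})"
    by (subst has_sum_cong_neutral[where T = "(\<lambda>i'. (i', q)) ` (- {i})"
          and g = "\<lambda>y. \<alpha> i (fst y) * g y"]) auto
  have eq: "?F1 y + ?F2 y + ?F3 y = jsq_rates \<alpha> l \<mu> (i, q) y * g y" if y: "y \<in> - {(i, q)}" for y
  proof (cases y)
    case (Pair i' q')
    show ?thesis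
    proof (cases "i' = i")
      case True
      then show ?thesis using y Pair
        by (auto simp: jsq_rates_def distrib_right sum_distrib_right intro!: arg_cong2[where f = "(+)"] sum.cong)
    next
      case False
      then show ?thesis using Pair by (auto simp: jsq_rates_def)
    qed
  qed
  from has_sum_add[OF has_sum_add[OF 1 2] 3] show ?thesis
    by (subst (asm) has_sum_cong[OF eq]) auto
qed

lemma out_rate_jsq_rates:
  assumes "is_rates \<alpha>"
  shows "out_rate (jsq_rates \<alpha> l \<mu>) (i, q) = l i + busy_rate \<mu> i q + out_rate \<alpha> i"
proof -
  have "((\<lambda>i'. \<alpha> i i' * 1) has_sum out_rate \<alpha> i) (- {i})"
    unfolding out_rate_def using assms by (auto simp: is_rates_def)
  from has_sum_jsq_rates[of \<alpha> i "\<lambda>_. 1" q, OF this, of l \<mu>] show ?thesis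
    using shortest_nonempty[of q] by (simp add: out_rate_def busy_rate_def infsumI)
qed

text \<open>One system at a fixed value of \<epsilon>. The bounds \<open>C\<close>,
  \<open>L\<close>, \<open>M\<close> are the same for all small \<epsilon>, which makes the
  estimates below uniform.\<close>

locale stationary_jsq =
  fixes \<alpha> :: "'z::countable \<Rightarrow> 'z \<Rightarrow> real" and PZ :: "real \<Rightarrow> 'z \<Rightarrow> 'z pmf" and \<pi> :: "'z pmf"
    and l :: "'z \<Rightarrow> real" and \<mu> :: "'z \<Rightarrow> 'n::finite \<Rightarrow> real" and C L M :: real
    and P :: "real \<Rightarrow> 'z \<times> 'n queues \<Rightarrow> ('z \<times> 'n queues) pmf" and \<nu> :: "('z \<times> 'n queues) pmf"
  assumes ctmc_Z: "is_ctmc \<alpha> PZ" and irr: "irreducible_chain PZ" and st_Z: "stationary PZ \<pi>"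
    and out_le: "\<And>i. out_rate \<alpha> i \<le> C"
    and \<mu>_nonneg: "\<And>i j. 0 \<le> \<mu> i j" and \<mu>_le: "\<And>i. (\<Sum>j\<in>UNIV. \<mu> i j) \<le> M"
    and l_nonneg: "\<And>i. 0 \<le> l i" and l_le: "\<And>i. l i \<le> L"
    and ctmc: "is_ctmc (jsq_rates \<alpha> l \<mu>) P" and st: "stationary P \<nu>"
begin

definition "service i = (\<Sum>j\<in>UNIV. \<mu> i j)"
definition "X a q = exp (- a * total_queue q)" for a :: real and q :: "'n queues"

lemma rates: "is_rates \<alpha>" "is_rates (jsq_rates \<alpha> l \<mu>)"
  using ctmc_Z ctmc by (auto simp: is_ctmc_def)

lemma busy_nonneg: "0 \<le> busy_rate \<mu> i q"
  by (simp add: busy_rate_def sum_nonneg \<mu>_nonneg)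

lemma busy_le_service: "busy_rate \<mu> i q \<le> service i"
  unfolding busy_rate_def service_def by (intro sum_mono2) (auto simp: \<mu>_nonneg)

lemma service_le: "service i \<le> M" using \<mu>_le by (simp add: service_def)

lemma service_nonneg: "0 \<le> service i" by (simp add: service_def sum_nonneg \<mu>_nonneg)

lemma X_pos: "0 < X a q" by (simp add: X_def)

lemma X_le_1: "0 \<le> a \<Longrightarrow> X a q \<le> 1"
  by (simp add: X_def total_queue_nonneg)

lemma out_le_jsq: "out_rate (jsq_rates \<alpha> l \<mu>) x \<le> L + M + C"
proof (cases x)
  case (Pair i q)
  then show ?thesis
    using out_le[of i] l_le[of i] order_trans[OF busy_le_service service_le, of i q]
    by (simp add: out_rate_jsq_rates[OF rates(1)])
qed

lemma balanced: "globally_balanced (jsq_rates \<alpha> l \<mu>) \<nu>"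
  by (rule stationary_imp_globally_balanced[OF ctmc st out_le_jsq])

section \<open>Testing joint balance against product functions\<close>

lemma integrable_X_mult:
  assumes "integrable \<nu> (\<lambda>(i, q). h i q)" "0 \<le> a"
  shows "integrable \<nu> (\<lambda>(i, q). X a q * h i q)"
  using X_le_1[OF assms(2)] X_pos
  by (intro Bochner_Integration.integrable_bound[OF assms(1)] AE_I2)
    (auto simp: abs_mult less_imp_le intro!: mult_left_le_one_le)

lemma integrable_mult_bounded:
  fixes h k :: "'z \<times> 'n queues \<Rightarrow> real"
  assumes "integrable \<nu> h" "\<And>x. \<bar>k x\<bar> \<le> B"
  shows "integrable \<nu> (\<lambda>x. h x * k x)"
proof (rule Bochner_Integration.integrable_bound[where f = "\<lambda>x. B * h x"])
  have B: "0 \<le> B" using assms(2) abs_ge_zero order_trans by blast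
  have "\<bar>h x\<bar> * \<bar>k x\<bar> \<le> \<bar>h x\<bar> * B" for x
    by (intro mult_left_mono assms) simp
  then show "AE x in \<nu>. norm (h x * k x) \<le> norm (B * h x)"
    using B by (intro AE_I2) (simp add: abs_mult mult.commute)
qed (use assms in auto)

text \<open>Balance is applied to \<open>X a q * h i\<close>. An arrival multiplies
  \<open>X a q\<close> by \<open>exp (- a)\<close> whichever queue it joins, a departure multiplies
  it by \<open>exp a\<close>, and \<open>T i - out_rate \<alpha> i * h i\<close> is the modulating
  generator applied to \<open>h\<close>.\<close>

lemma generator_identity:
  assumes a: "0 \<le> a" and h: "integrable \<nu> (\<lambda>(i, q). h i)"
    and T: "\<And>i. ((\<lambda>i'. \<alpha> i i' * h i') has_sum T i) (- {i})"
  shows "has_bochner_integral \<nu> (\<lambda>(i, q). X a q *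
     (h i * (l i * (exp (- a) - 1) + busy_rate \<mu> i q * (exp a - 1)) + (T i - out_rate \<alpha> i * h i))) 0"
proof -
  let ?r = "jsq_rates \<alpha> l \<mu>"
  define g where "g = (\<lambda>(i, q). X a q * h i)"
  have gi: "integrable \<nu> g" unfolding g_def by (rule integrable_X_mult[OF h a])
  have sums: "((\<lambda>y. jump_rate ?r (i, q) y * g y) has_sum
      (X a q * (h i * (l i * exp (- a) + busy_rate \<mu> i q * exp a) + T i))) UNIV" for i q
  proof -
    have "((\<lambda>i'. \<alpha> i i' * g (i', q)) has_sum X a q * T i) (- {i})"
      using has_sum_cmult_right[OF T[of i], of "X a q"] by (simp add: g_def mult_ac)
    from has_sum_jump_rate[of ?r "(i, q)" g, OF has_sum_jsq_rates[of \<alpha> i g q "X a q * T i" l \<mu>, OF this]]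
    have 1: "((\<lambda>y. jump_rate ?r (i, q) y * g y) has_sum
        ((\<Sum>j\<in>shortest q. l i / real (card (shortest q)) * g (i, add_job j q))
         + (\<Sum>j | 0 < q $ j. \<mu> i j * g (i, remove_job j q)) + X a q * T i)) UNIV" .
    have "(\<Sum>j\<in>shortest q. l i / real (card (shortest q)) * g (i, add_job j q))
        = (\<Sum>j\<in>shortest q. l i / real (card (shortest q)) * (X a q * exp (- a) * h i))"
      by (intro sum.cong) (auto simp: g_def X_def total_queue_add_job distrib_left exp_add[symmetric])
    also have "\<dots> = X a q * (h i * (l i * exp (- a)))"
      using shortest_nonempty[of q] by simp
    finally have 2: "(\<Sum>j\<in>shortest q. l i / real (card (shortest q)) * g (i, add_job j q))
        = X a q * (h i * (l i * exp (- a)))" .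
    have "(\<Sum>j | 0 < q $ j. \<mu> i j * g (i, remove_job j q))
        = (\<Sum>j | 0 < q $ j. \<mu> i j * (X a q * exp a * h i))"
      by (intro sum.cong) (auto simp: g_def X_def total_queue_remove_job algebra_simps exp_add[symmetric])
    also have "\<dots> = X a q * (h i * (busy_rate \<mu> i q * exp a))"
      by (simp add: busy_rate_def sum_distrib_right[symmetric])
    finally have 3: "(\<Sum>j | 0 < q $ j. \<mu> i j * g (i, remove_job j q)) = X a q * (h i * (busy_rate \<mu> i q * exp a))" .
    show ?thesis using 1 unfolding 2 3 by (simp add: algebra_simps)
  qed
  note K = has_sum_imp_integrable_count_space[OF sums]
  have Ki: "integrable (count_space UNIV) (\<lambda>y. jump_rate ?r x y * g y)" for x
    using K(1) by (cases x) auto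
  have oi: "integrable \<nu> (\<lambda>x. out_rate ?r x * g x)"
    using integrable_mult_bounded[OF gi, of "out_rate ?r" "L + M + C"] out_le_jsq out_rate_nonneg[OF rates(2)]
    by (simp add: mult.commute)
  have "has_bochner_integral \<nu> (\<lambda>x. (\<integral>y. jump_rate ?r x y * g y \<partial>count_space UNIV) - out_rate ?r x * g x) 0"
    using has_bochner_integral_diff[OF globally_balanced_integral[OF rates(2) balanced out_le_jsq gi Ki]
        has_bochner_integral_integrable[OF oi]] by simp
  also have "(\<lambda>x. (\<integral>y. jump_rate ?r x y * g y \<partial>count_space UNIV) - out_rate ?r x * g x)
    = (\<lambda>(i, q). X a q *
     (h i * (l i * (exp (- a) - 1) + busy_rate \<mu> i q * (exp a - 1)) + (T i - out_rate \<alpha> i * h i)))"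
    using K(2) by (auto simp: fun_eq_iff out_rate_jsq_rates[OF rates(1)] g_def algebra_simps)
  finally show ?thesis .
qed

text \<open>The joint semigroup is tied to \<open>PZ\<close> only through the rates, so stationarity
  of the marginal under \<open>PZ\<close> is not immediate. Testing with \<open>a = 0\<close> and
  the indicator of one modulating state makes the marginal globally balanced, and uniqueness
  identifies it.\<close>

lemma marginal: "map_pmf fst \<nu> = \<pi>"
proof (rule globally_balanced_unique[OF ctmc_Z irr st_Z out_le])
  show "globally_balanced \<alpha> (map_pmf fst \<nu>)"
    unfolding globally_balanced_def
  proof
    fix k
    have T: "((\<lambda>i'. \<alpha> i i' * indicator {k} i') has_sum jump_rate \<alpha> i k) (- {i})" for i
    proof (cases "i = k")
      case True
      then show ?thesis
        by (subst has_sum_cong[where g = "\<lambda>_. 0"]) (auto simp: jump_rate_def indicator_def)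
    next
      case False
      have "((\<lambda>i'. if i' = k then \<alpha> i i' else 0) has_sum \<alpha> i k) (- {i})"
        using False by (intro has_sum_single_point) auto
      then show ?thesis using False
        by (subst has_sum_cong[where g = "\<lambda>i'. if i' = k then \<alpha> i i' else 0"])
          (auto simp: jump_rate_def indicator_def)
    qed
    have h: "integrable \<nu> (\<lambda>(i, q). indicator {k} i :: real)"
      by (rule measure_pmf.integrable_const_bound[where B=1]) (auto simp: indicator_def)
    have net: "has_bochner_integral \<nu> (\<lambda>(i, q). jump_rate \<alpha> i k - out_rate \<alpha> i * indicator {k} i) 0"
      using generator_identity[OF order_refl h T] by (simp add: X_def case_prod_unfold)
    have oi: "integrable \<nu> (\<lambda>(i, q). out_rate \<alpha> i * indicator {k} i)"
      by (rule measure_pmf.integrable_const_bound[where B = "out_rate \<alpha> k"])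
        (auto simp: indicator_def out_rate_nonneg[OF rates(1)])
    have ov: "(\<integral>x. (case x of (i, q) \<Rightarrow> out_rate \<alpha> i * indicator {k} i) \<partial>\<nu>) = pmf (map_pmf fst \<nu>) k * out_rate \<alpha> k"
    proof -
      have "(\<integral>x. (case x of (i, q) \<Rightarrow> out_rate \<alpha> i * indicator {k} i) \<partial>\<nu>)
          = (\<integral>x. out_rate \<alpha> k * indicator {k} (fst x) \<partial>\<nu>)"
        by (intro Bochner_Integration.integral_cong) (auto simp: indicator_def)
      also have "\<dots> = (\<integral>i. out_rate \<alpha> k * indicator {k} i \<partial>map_pmf fst \<nu>)"
        by (rule integral_map_pmf[symmetric])
      also have "\<dots> = pmf (map_pmf fst \<nu>) k * out_rate \<alpha> k"
        by (simp del: integral_map_pmf add: measure_pmf_single)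
      finally show ?thesis .
    qed
    have "has_bochner_integral \<nu> (\<lambda>(i, q). jump_rate \<alpha> i k) (pmf (map_pmf fst \<nu>) k * out_rate \<alpha> k)"
      using has_bochner_integral_add[OF net has_bochner_integral_integrable[OF oi]] ov
      by (simp add: case_prod_unfold)
    then have "(\<integral>\<^sup>+x. ennreal (case x of (i, q) \<Rightarrow> jump_rate \<alpha> i k) \<partial>\<nu>)
        = ennreal (pmf (map_pmf fst \<nu>) k * out_rate \<alpha> k)"
      using nn_integral_eq_integral[of \<nu> "\<lambda>(i, q). jump_rate \<alpha> i k"] jump_rate_nonneg[OF rates(1)]
      by (auto simp: has_bochner_integral_iff case_prod_unfold)
    then show "(\<integral>\<^sup>+x. ennreal (jump_rate \<alpha> x k) \<partial>map_pmf fst \<nu>) = ennreal (pmf (map_pmf fst \<nu>) k * out_rate \<alpha> k)"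
      by (simp add: case_prod_unfold)
  qed
qed

lemma integrable_fst:
  fixes h :: "'z \<Rightarrow> real"
  shows "integrable \<pi> h \<Longrightarrow> integrable \<nu> (\<lambda>(i, q). h i)"
  unfolding marginal[symmetric] by (simp add: case_prod_unfold)

lemma integral_fst:
  fixes h :: "'z \<Rightarrow> real"
  shows "(\<integral>x. (case x of (i, q) \<Rightarrow> h i) \<partial>\<nu>) = (\<integral>i. h i \<partial>\<pi>)"
  unfolding marginal[symmetric] by (simp add: case_prod_unfold)

text \<open>Testing stationarity against \<open>exp (- a * total_queue q)\<close> and letting \<open>a\<close> tend to zero
  avoids assuming that the mean queue length is finite.\<close>

lemma arrival_le_busy: "(\<integral>i. l i \<partial>\<pi>) \<le> (\<integral>x. (case x of (i, q) \<Rightarrow> busy_rate \<mu> i q) \<partial>\<nu>)"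
proof -
  have li: "integrable \<nu> (\<lambda>(i, q). l i)"
    by (rule measure_pmf.integrable_const_bound[where B=L]) (auto simp: l_nonneg l_le)
  have bi: "integrable \<nu> (\<lambda>(i, q). busy_rate \<mu> i q)"
    by (rule measure_pmf.integrable_const_bound[where B=M])
      (auto simp: busy_nonneg order_trans[OF busy_le_service service_le])
  let ?B = "\<integral>x. (case x of (i, q) \<Rightarrow> busy_rate \<mu> i q) \<partial>\<nu>"
  have T: "((\<lambda>i'. \<alpha> i i' * 1) has_sum out_rate \<alpha> i) (- {i})" for i
    unfolding out_rate_def using rates by (auto simp: is_rates_def)
  have le: "exp (- a) * (\<integral>x. (case x of (i, q) \<Rightarrow> X a q * l i) \<partial>\<nu>) \<le> ?B" if a: "0 < a" for a
  proof -
    have Xl: "integrable \<nu> (\<lambda>(i, q). X a q * l i)" and Xb: "integrable \<nu> (\<lambda>(i, q). X a q * busy_rate \<mu> i q)"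
      using integrable_X_mult[OF li] integrable_X_mult[OF bi] a by auto
    have "has_bochner_integral \<nu> (\<lambda>(i, q). X a q * (l i * (exp (- a) - 1) + busy_rate \<mu> i q * (exp a - 1))) 0"
      using generator_identity[of a "\<lambda>_. 1", OF _ _ T] a by (simp add: case_prod_unfold)
    then have "0 = (\<integral>x. (exp (- a) - 1) * (case x of (i, q) \<Rightarrow> X a q * l i)
        + (exp a - 1) * (case x of (i, q) \<Rightarrow> X a q * busy_rate \<mu> i q) \<partial>\<nu>)"
      by (simp add: has_bochner_integral_iff case_prod_unfold algebra_simps)
    also have "\<dots> = (exp (- a) - 1) * (\<integral>x. (case x of (i, q) \<Rightarrow> X a q * l i) \<partial>\<nu>)
        + (exp a - 1) * (\<integral>x. (case x of (i, q) \<Rightarrow> X a q * busy_rate \<mu> i q) \<partial>\<nu>)"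
      using Xl Xb by simp
    \<comment> \<open>With this factorisation the positive factor \<open>exp a - 1\<close> cancels
      from the identity, leaving one that survives the limit \<open>a\<close> to 0.\<close>
    also have "exp (- a) - 1 = - ((exp a - 1) * exp (- a))"
      by (simp add: algebra_simps exp_minus_inverse)
    finally have "(exp a - 1) * (exp (- a) * (\<integral>x. (case x of (i, q) \<Rightarrow> X a q * l i) \<partial>\<nu>))
        = (exp a - 1) * (\<integral>x. (case x of (i, q) \<Rightarrow> X a q * busy_rate \<mu> i q) \<partial>\<nu>)"
      by (simp add: algebra_simps)
    then have "exp (- a) * (\<integral>x. (case x of (i, q) \<Rightarrow> X a q * l i) \<partial>\<nu>)
        = (\<integral>x. (case x of (i, q) \<Rightarrow> X a q * busy_rate \<mu> i q) \<partial>\<nu>)"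
      using a by simp
    also have "\<dots> \<le> ?B"
      using X_le_1[of a] X_pos[of a] a
      by (intro integral_mono Xb bi) (auto simp: busy_nonneg less_imp_le intro!: mult_left_le_one_le)
    finally show ?thesis .
  qed
  have lim0: "(\<lambda>k. 1 / real (Suc k)) \<longlonglongrightarrow> 0" by (rule LIMSEQ_Suc[OF lim_const_over_n])
  \<comment> \<open>Take \<open>a = 1 / Suc k\<close>: then \<open>X a q\<close> tends to 1 and
    stays at most 1, so \<open>l\<close> itself dominates.\<close>
  have "(\<lambda>k. \<integral>x. (case x of (i, q) \<Rightarrow> X (1 / real (Suc k)) q * l i) \<partial>\<nu>) \<longlonglongrightarrow> (\<integral>x. (case x of (i, q) \<Rightarrow> l i) \<partial>\<nu>)"
  proof (rule integral_dominated_convergence[OF _ _ li])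
    show "AE x in \<nu>. (\<lambda>k. case x of (i, q) \<Rightarrow> X (1 / real (Suc k)) q * l i) \<longlonglongrightarrow> (case x of (i, q) \<Rightarrow> l i)"
    proof (rule AE_I2, clarify)
      fix i :: 'z and q :: "'n queues"
      have "(\<lambda>k. exp (- (1 / real (Suc k)) * total_queue q) * l i) \<longlonglongrightarrow> exp (- 0 * total_queue q) * l i"
        by (intro tendsto_intros lim0)
      then show "(\<lambda>k. X (1 / real (Suc k)) q * l i) \<longlonglongrightarrow> l i" by (simp add: X_def)
    qed
    show "AE x in \<nu>. norm (case x of (i, q) \<Rightarrow> X (1 / real (Suc k)) q * l i) \<le> (case x of (i, q) \<Rightarrow> l i)" for k
      using X_le_1[of "1 / real (Suc k)"] X_pos
      by (intro AE_I2) (auto simp: abs_mult l_nonneg less_imp_le intro!: mult_left_le_one_le)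
  qed auto
  moreover have "(\<lambda>k. exp (- (1 / real (Suc k)))) \<longlonglongrightarrow> exp (- 0)"
    by (intro tendsto_intros lim0)
  ultimately have "(\<lambda>k. exp (- (1 / real (Suc k))) * (\<integral>x. (case x of (i, q) \<Rightarrow> X (1 / real (Suc k)) q * l i) \<partial>\<nu>))
      \<longlonglongrightarrow> exp (- 0) * (\<integral>x. (case x of (i, q) \<Rightarrow> l i) \<partial>\<nu>)"
    by (intro tendsto_mult)
  then have "exp (- 0) * (\<integral>x. (case x of (i, q) \<Rightarrow> l i) \<partial>\<nu>) \<le> ?B"
    by (rule LIMSEQ_le_const2) (auto intro!: le)
  then show ?thesis by (simp add: integral_fst)
qed

section \<open>From the covariance to an explicit error bound\<close>

lemma covariance_eq_generator:
  assumes V: "poisson_solution \<alpha> \<pi> f V" "integrable \<pi> V" and a: "0 \<le> a"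
  shows "covariance \<nu> (\<lambda>(i, q). X a q) (\<lambda>(i, q). f i)
     = (\<integral>x. (case x of (i, q) \<Rightarrow>
          X a q * (V i * (l i * (exp (- a) - 1) + busy_rate \<mu> i q * (exp a - 1)))) \<partial>\<nu>)"
proof -
  define m where "m = measure_pmf.expectation \<pi> f"
  have f: "integrable \<pi> f" using V by (simp add: poisson_solution_def)
  have fm: "integrable \<nu> (\<lambda>(i, q). f i - m)" using f by (intro integrable_fst) auto
  have Xfm: "integrable \<nu> (\<lambda>(i, q). X a q * (f i - m))" by (rule integrable_X_mult[OF fm a])
  have "has_bochner_integral \<nu> (\<lambda>(i, q). X a q *
     (V i * (l i * (exp (- a) - 1) + busy_rate \<mu> i q * (exp a - 1))
       + ((out_rate \<alpha> i * V i - (f i - m)) - out_rate \<alpha> i * V i))) 0"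
    unfolding m_def
    by (rule generator_identity[OF a integrable_fst[OF V(2)] poisson_has_sum[OF ctmc_Z irr V(1)]])
  from has_bochner_integral_add[OF this has_bochner_integral_integrable[OF Xfm]]
  have gen: "(\<integral>x. (case x of (i, q) \<Rightarrow>
          X a q * (V i * (l i * (exp (- a) - 1) + busy_rate \<mu> i q * (exp a - 1)))) \<partial>\<nu>)
      = (\<integral>x. (case x of (i, q) \<Rightarrow> X a q * (f i - m)) \<partial>\<nu>)"
    by (simp add: has_bochner_integral_iff case_prod_unfold algebra_simps)
  have mean0: "(\<integral>x. (case x of (i, q) \<Rightarrow> f i - m) \<partial>\<nu>) = 0"
    using f by (simp add: integral_fst m_def)
  have fnu: "(\<integral>x. (case x of (i, q) \<Rightarrow> f i) \<partial>\<nu>) = m" by (simp add: integral_fst m_def)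
  \<comment> \<open>Centering \<open>X a q\<close> as well subtracts \<open>E\<close> times the mean
    of \<open>f i - m\<close>, which is zero.\<close>
  define E where "E = (\<integral>x. (case x of (i, q) \<Rightarrow> X a q) \<partial>\<nu>)"
  have "covariance \<nu> (\<lambda>(i, q). X a q) (\<lambda>(i, q). f i)
      = (\<integral>x. (case x of (i, q) \<Rightarrow> X a q * (f i - m)) - E * (case x of (i, q) \<Rightarrow> f i - m) \<partial>\<nu>)"
    unfolding covariance_def fnu E_def[symmetric] by (simp add: case_prod_unfold algebra_simps)
  also have "\<dots> = (\<integral>x. (case x of (i, q) \<Rightarrow> X a q * (f i - m)) \<partial>\<nu>)"
    using Xfm fm mean0 by simp
  finally show ?thesis using gen by simp
qed

text \<open>The truncation level \<open>K\<close> stays free, so that it can be matched to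
  \<epsilon> at the end. The difference of the two service and arrival means bounds the mean idle
  service rate.\<close>

lemma covariance_error_bound:
  assumes V: "poisson_solution \<alpha> \<pi> f V" and mom: "integrable \<pi> (\<lambda>i. \<bar>V i\<bar> powr (1 + \<xi>))"
    and pos: "0 < \<xi>" "0 < a" "0 < K"
  shows "\<bar>covariance \<nu> (\<lambda>(i, q). X a q) (\<lambda>(i, q). f i)
      - (exp (- a) - 1) * (\<integral>x. (case x of (i, q) \<Rightarrow> X a q * V i * (l i - service i)) \<partial>\<nu>)\<bar>
    \<le> (exp a - 1)\<^sup>2 * (M * (\<integral>i. \<bar>V i\<bar> \<partial>\<pi>))
      + (exp a - 1) * (K * ((\<integral>i. service i \<partial>\<pi>) - (\<integral>i. l i \<partial>\<pi>))
          + K powr (- \<xi>) * (M * (\<integral>i. \<bar>V i\<bar> powr (1 + \<xi>) \<partial>\<pi>)))"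
    (is "\<bar>?cov - _\<bar> \<le> _")
proof -
  let ?e = "exp a - 1"
  have e: "0 < ?e" using pos by simp
  have a0: "0 \<le> a" using pos by simp
  have Vi: "integrable \<pi> V" by (rule integrable_of_powr_moment[OF mom pos(1)])
  have Vn: "integrable \<nu> (\<lambda>(i, q). V i)" by (rule integrable_fst[OF Vi])
  define idle where "idle i q = service i - busy_rate \<mu> i q" for i q
  have idle: "0 \<le> idle i q" "idle i q \<le> M" for i q
    using busy_le_service[of i q] service_le[of i] busy_nonneg[of i q] by (auto simp: idle_def)
  have bdd: "\<bar>l i\<bar> \<le> L" "\<bar>service i\<bar> \<le> M" "\<bar>busy_rate \<mu> i q\<bar> \<le> M" for i q
    using l_nonneg l_le service_nonneg service_le busy_nonneg order_trans[OF busy_le_service service_le] by auto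
  have int: "integrable \<nu> (\<lambda>x. (case x of (i, q) \<Rightarrow> X a q * V i) * k x)" if "\<And>x. \<bar>k x\<bar> \<le> B" for k B
    using integrable_mult_bounded[OF integrable_X_mult[OF Vn a0] that] .
  have i1: "integrable \<nu> (\<lambda>(i, q). X a q * V i * l i)"
    using int[of "\<lambda>(i, q). l i" L] bdd by (simp add: case_prod_unfold)
  have i2: "integrable \<nu> (\<lambda>(i, q). X a q * V i * service i)"
    using int[of "\<lambda>(i, q). service i" M] bdd by (simp add: case_prod_unfold)
  have i3: "integrable \<nu> (\<lambda>(i, q). X a q * V i * busy_rate \<mu> i q)"
    using int[of "\<lambda>(i, q). busy_rate \<mu> i q" M] bdd by (simp add: case_prod_unfold)
  \<comment> \<open>Substituting \<open>service i - idle i q\<close> for the busy rate cancels the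
    arrival terms. The coefficients of \<open>service i\<close> add up to
    \<open>exp a + exp (- a) - 2\<close>, which is of second order in \<open>a\<close>.\<close>
  define R where "R = (\<lambda>(i, q). X a q * V i * ((exp (- a) * ?e\<^sup>2) * service i - ?e * idle i q))"
  have ea: "exp (- a) * ?e\<^sup>2 = exp a + exp (- a) - 2"
    by (simp add: power2_eq_square algebra_simps exp_minus_inverse)
  have "?cov - (exp (- a) - 1) * (\<integral>x. (case x of (i, q) \<Rightarrow> X a q * V i * (l i - service i)) \<partial>\<nu>)
      = (\<integral>x. (case x of (i, q) \<Rightarrow> X a q * (V i * (l i * (exp (- a) - 1) + busy_rate \<mu> i q * ?e)))
           - (exp (- a) - 1) * (case x of (i, q) \<Rightarrow> X a q * V i * (l i - service i)) \<partial>\<nu>)"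
    unfolding covariance_eq_generator[OF V Vi a0]
  proof (subst Bochner_Integration.integral_diff)
    have "integrable \<nu> (\<lambda>x. (exp (- a) - 1) * (case x of (i, q) \<Rightarrow> X a q * V i * l i)
        + ?e * (case x of (i, q) \<Rightarrow> X a q * V i * busy_rate \<mu> i q))"
      by (intro Bochner_Integration.integrable_add integrable_mult_right i1 i3)
    then show "integrable \<nu> (\<lambda>x. case x of (i, q) \<Rightarrow>
        X a q * (V i * (l i * (exp (- a) - 1) + busy_rate \<mu> i q * ?e)))"
      by (simp add: case_prod_unfold algebra_simps)
    have "integrable \<nu> (\<lambda>(i, q). X a q * V i * (l i - service i))"
      using Bochner_Integration.integrable_diff[OF i1 i2] by (simp add: case_prod_unfold algebra_simps)
    then show "integrable \<nu> (\<lambda>x. (exp (- a) - 1) * (case x of (i, q) \<Rightarrow> X a q * V i * (l i - service i)))"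
      by (rule integrable_mult_right)
  qed simp
  also have "\<dots> = (\<integral>x. R x \<partial>\<nu>)"
    unfolding R_def ea idle_def
    by (intro Bochner_Integration.integral_cong) (auto simp: algebra_simps)
  finally have eq: "?cov - (exp (- a) - 1) * (\<integral>x. (case x of (i, q) \<Rightarrow> X a q * V i * (l i - service i)) \<partial>\<nu>)
      = (\<integral>x. R x \<partial>\<nu>)" .
  \<comment> \<open>Majorant of \<open>R\<close>. In \<open>\<bar>V i\<bar> * idle i q\<close> the
    part below the level \<open>K\<close> keeps \<open>idle\<close>, whose mean is small, while the
    tail uses \<open>idle i q \<le> M\<close> and is paid for by the moment of order
    \<open>1 + \<xi>\<close>.\<close>
  define G where "G = (\<lambda>(i, q). ?e\<^sup>2 * (M * \<bar>V i\<bar>)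
      + ?e * (K * idle i q + K powr (- \<xi>) * (M * \<bar>V i\<bar> powr (1 + \<xi>))))"
  have RG: "\<bar>R x\<bar> \<le> G x" for x
  proof (cases x)
    case (Pair i q)
    let ?b = "(exp (- a) * ?e\<^sup>2) * service i - ?e * idle i q"
    have "\<bar>?b\<bar> \<le> (exp (- a) * ?e\<^sup>2) * service i + ?e * idle i q"
      using e idle(1)[of i q] service_nonneg[of i] by (auto simp: abs_le_iff add_increasing2 add_increasing)
    also have "\<dots> \<le> ?e\<^sup>2 * M + ?e * idle i q"
      using pos service_nonneg[of i] service_le[of i]
      by (intro add_right_mono mult_mono mult_left_le_one_le) auto
    finally have b: "\<bar>?b\<bar> \<le> ?e\<^sup>2 * M + ?e * idle i q" .
    have "\<bar>R x\<bar> = X a q * (\<bar>V i\<bar> * \<bar>?b\<bar>)"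
      using X_pos[of a q] by (simp add: R_def Pair abs_mult)
    also have "\<dots> \<le> \<bar>V i\<bar> * \<bar>?b\<bar>"
      using X_pos[of a q] X_le_1[OF a0, of q] by (intro mult_left_le_one_le) auto
    also have "\<dots> \<le> \<bar>V i\<bar> * (?e\<^sup>2 * M + ?e * idle i q)"
      using b by (intro mult_left_mono) auto
    also have "\<dots> = ?e\<^sup>2 * (M * \<bar>V i\<bar>) + ?e * (\<bar>V i\<bar> * idle i q)" by (simp add: algebra_simps)
    also have "\<bar>V i\<bar> * idle i q \<le> (K + K powr (- \<xi>) * \<bar>V i\<bar> powr (1 + \<xi>)) * idle i q"
      using idle pos by (intro mult_right_mono le_add_powr_truncation) auto
    also have "\<dots> = K * idle i q + K powr (- \<xi>) * (idle i q * \<bar>V i\<bar> powr (1 + \<xi>))"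
      by (simp add: algebra_simps)
    also have "\<dots> \<le> K * idle i q + K powr (- \<xi>) * (M * \<bar>V i\<bar> powr (1 + \<xi>))"
      using idle by (intro add_left_mono mult_left_mono mult_right_mono) auto
    finally show ?thesis using e by (simp add: G_def Pair)
  qed
  have idle_i: "integrable \<nu> (\<lambda>(i, q). idle i q)"
    using idle by (intro measure_pmf.integrable_const_bound[where B=M]) auto
  have g1: "integrable \<nu> (\<lambda>(i, q). \<bar>V i\<bar>)" and g2: "integrable \<nu> (\<lambda>(i, q). \<bar>V i\<bar> powr (1 + \<xi>))"
    using Vi mom by (auto intro!: integrable_fst)
  have G_eq: "G = (\<lambda>x. ?e\<^sup>2 * (M * (case x of (i, q) \<Rightarrow> \<bar>V i\<bar>))
      + ?e * (K * (case x of (i, q) \<Rightarrow> idle i q)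
          + K powr (- \<xi>) * (M * (case x of (i, q) \<Rightarrow> \<bar>V i\<bar> powr (1 + \<xi>)))))"
    by (auto simp: G_def)
  have Gi: "integrable \<nu> G" unfolding G_eq using g1 g2 idle_i by auto
  have "\<bar>\<integral>x. R x \<partial>\<nu>\<bar> \<le> (\<integral>x. G x \<partial>\<nu>)"
  proof -
    have "\<bar>\<integral>x. R x \<partial>\<nu>\<bar> \<le> (\<integral>x. \<bar>R x\<bar> \<partial>\<nu>)" by (rule integral_abs_bound)
    also have "\<dots> \<le> (\<integral>x. G x \<partial>\<nu>)"
    proof (intro integral_mono Gi RG)
      show "integrable \<nu> (\<lambda>x. \<bar>R x\<bar>)"
        by (rule Bochner_Integration.integrable_bound[OF Gi]) (auto intro!: AE_I2 order_trans[OF RG])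
    qed
    finally show ?thesis .
  qed
  also have "(\<integral>x. G x \<partial>\<nu>) = ?e\<^sup>2 * (M * (\<integral>i. \<bar>V i\<bar> \<partial>\<pi>))
      + ?e * (K * (\<integral>x. (case x of (i, q) \<Rightarrow> idle i q) \<partial>\<nu>)
          + K powr (- \<xi>) * (M * (\<integral>i. \<bar>V i\<bar> powr (1 + \<xi>) \<partial>\<pi>)))"
    unfolding G_eq using g1 g2 idle_i
    by (simp add: integral_fst[of "\<lambda>i. \<bar>V i\<bar>"] integral_fst[of "\<lambda>i. \<bar>V i\<bar> powr (1 + \<xi>)"])
  also have "(\<integral>x. (case x of (i, q) \<Rightarrow> idle i q) \<partial>\<nu>) \<le> (\<integral>i. service i \<partial>\<pi>) - (\<integral>i. l i \<partial>\<pi>)"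
  proof -
    have si: "integrable \<nu> (\<lambda>(i, q). service i)" and bi: "integrable \<nu> (\<lambda>(i, q). busy_rate \<mu> i q)"
      using bdd by (auto intro!: measure_pmf.integrable_const_bound[where B=M])
    have "(\<integral>x. (case x of (i, q) \<Rightarrow> idle i q) \<partial>\<nu>)
      = (\<integral>x. (case x of (i, q) \<Rightarrow> service i) - (case x of (i, q) \<Rightarrow> busy_rate \<mu> i q) \<partial>\<nu>)"
      by (simp add: idle_def case_prod_unfold)
    also have "\<dots> = (\<integral>i. service i \<partial>\<pi>) - (\<integral>x. (case x of (i, q) \<Rightarrow> busy_rate \<mu> i q) \<partial>\<nu>)"
      by (simp only: Bochner_Integration.integral_diff[OF si bi] integral_fst)
    finally show ?thesis using arrival_le_busy by simp
  qed
  finally show ?thesis unfolding eq using e pos by (simp add: mult_left_mono)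
qed

end

section \<open>Heavy-traffic asymptotics\<close>

theorem theorem4:
  fixes \<alpha> :: "'z::countable \<Rightarrow> 'z \<Rightarrow> real"
    and PZ :: "real \<Rightarrow> 'z \<Rightarrow> 'z pmf"
    and \<pi> :: "'z pmf"
    and lam :: "real \<Rightarrow> 'z \<Rightarrow> real"
    and \<mu> :: "'z \<Rightarrow> 'n::finite \<Rightarrow> real"
    and lam_max \<mu>_max \<epsilon>0 :: real
    and P :: "real \<Rightarrow> real \<Rightarrow> 'z \<times> 'n queues \<Rightarrow> ('z \<times> 'n queues) pmf"
    and \<nu> :: "real \<Rightarrow> ('z \<times> 'n queues) pmf"
    and f V :: "'z \<Rightarrow> real"
    and \<xi> s :: real
  assumes modulating_chain: "is_ctmc \<alpha> PZ" "ergodic_chain PZ" "stationary PZ \<pi>"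
    and bounded_rates: "bdd_above (range (out_rate \<alpha>))"
    and service: "\<And>i j. 0 \<le> \<mu> i j" "\<And>i j. \<mu> i j < \<mu>_max"
    and eps0: "0 < \<epsilon>0"
    and arrival: "\<And>\<epsilon> i. \<epsilon> \<in> {0<..<\<epsilon>0} \<Longrightarrow> 0 \<le> lam \<epsilon> i"
      "\<And>\<epsilon> i. \<epsilon> \<in> {0<..<\<epsilon>0} \<Longrightarrow> lam \<epsilon> i < lam_max"
    and heavy_traffic: "\<And>\<epsilon>. \<epsilon> \<in> {0<..<\<epsilon>0} \<Longrightarrow> \<epsilon> = 1 - load \<pi> (lam \<epsilon>) \<mu>"
    and jsq_chain: "\<And>\<epsilon>. \<epsilon> \<in> {0<..<\<epsilon>0} \<Longrightarrow> is_ctmc (jsq_rates \<alpha> (lam \<epsilon>) \<mu>) (P \<epsilon>)"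
      "\<And>\<epsilon>. \<epsilon> \<in> {0<..<\<epsilon>0} \<Longrightarrow> positive_recurrent (P \<epsilon>)"
      "\<And>\<epsilon>. \<epsilon> \<in> {0<..<\<epsilon>0} \<Longrightarrow> stationary (P \<epsilon>) (\<nu> \<epsilon>)"
    and poisson: "poisson_solution \<alpha> \<pi> f V"
    and xi: "0 < \<xi>"
    and moment: "integrable (measure_pmf \<pi>) (\<lambda>i. \<bar>V i\<bar> powr (1 + \<xi>))"
    and s: "0 < s"
  shows "(\<lambda>\<epsilon>. covariance (measure_pmf (\<nu> \<epsilon>))
                  (\<lambda>(i, q). exp (- s * \<epsilon> * total_queue q)) (\<lambda>(i, q). f i)
              - (exp (- s * \<epsilon>) - 1) *
                measure_pmf.expectation (\<nu> \<epsilon>)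
                  (\<lambda>(i, q). exp (- s * \<epsilon> * total_queue q) * V i
                              * (lam \<epsilon> i - (\<Sum>j\<in>UNIV. \<mu> i j))))
         \<in> O[at_right 0](\<lambda>\<epsilon>. \<epsilon> powr (2 - 1 / (1 + \<xi>)))"
proof -
  obtain C where C: "\<And>i. out_rate \<alpha> i \<le> C"
    using bounded_rates by (auto simp: bdd_above_def)
  define M where "M = (\<Sum>j\<in>(UNIV :: 'n set). \<mu>_max)"
  define S where "S = (\<integral>i. (\<Sum>j\<in>UNIV. \<mu> i j) \<partial>\<pi>)"
  define v where "v = (\<integral>i. \<bar>V i\<bar> \<partial>\<pi>)"
  define m where "m = (\<integral>i. \<bar>V i\<bar> powr (1 + \<xi>) \<partial>\<pi>)"
  define \<beta> where "\<beta> = 1 - 1 / (1 + \<xi>)"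
  have \<beta>: "\<beta> = \<xi> / (1 + \<xi>)" using xi by (simp add: \<beta>_def field_simps)
  have sum_le: "(\<Sum>j\<in>UNIV. \<mu> i j) \<le> M" for i
    unfolding M_def by (intro sum_mono less_imp_le service)
  have M0: "0 \<le> M"
    using order_trans[OF sum_nonneg sum_le] service(1) by blast
  have S0: "0 \<le> S" unfolding S_def by (intro integral_nonneg_AE AE_I2 sum_nonneg service)
  have v0: "0 \<le> v" and m0: "0 \<le> m" unfolding v_def m_def by (auto intro!: integral_nonneg_AE)
  have S_eq: "S = (\<Sum>j\<in>UNIV. mean_service_rate \<pi> \<mu> j)"
    unfolding S_def mean_service_rate_def
  proof (rule Bochner_Integration.integral_sum)
    show "integrable \<pi> (\<lambda>i. \<mu> i j)" for j
      using service by (intro measure_pmf.integrable_const_bound[where B = \<mu>_max]) (auto simp: less_imp_le)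
  qed
  \<comment> \<open>The constant comes from
    \<open>exp (s * \<epsilon>) - 1 \<le> \<epsilon> * (s * exp s)\<close>. Restricting to
    \<open>\<epsilon> < 1\<close> gives this bound and lets \<epsilon> squared be absorbed into the
    smaller power.\<close>
  show ?thesis
  proof (rule bigoI[where c = "(s * exp s)\<^sup>2 * (M * v) + (s * exp s) * (S + M * m)"],
      rule eventually_at_rightI[where b = "min \<epsilon>0 1"])
    fix \<epsilon> :: real
    assume "\<epsilon> \<in> {0<..<min \<epsilon>0 1}"
    then have \<epsilon>: "\<epsilon> \<in> {0<..<\<epsilon>0}" "0 < \<epsilon>" "\<epsilon> < 1" by auto
    interpret stationary_jsq \<alpha> PZ \<pi> "lam \<epsilon>" \<mu> C lam_max M "P \<epsilon>" "\<nu> \<epsilon>"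
      using modulating_chain service(1) sum_le C arrival[OF \<epsilon>(1)] jsq_chain[OF \<epsilon>(1)]
      by unfold_locales (auto simp: ergodic_chain_def less_imp_le)
    \<comment> \<open>The level \<open>?K\<close> equalises the two truncation costs:
      \<open>?K * \<epsilon>\<close> from the mean idle rate and \<open>?K powr (- \<xi>)\<close>
      from the tail are both \<open>\<epsilon> powr \<beta>\<close>.\<close>
    let ?a = "s * \<epsilon>" and ?K = "\<epsilon> powr (- 1 / (1 + \<xi>))" and ?e = "exp (s * \<epsilon>) - 1"
    \<comment> \<open>If \<open>S\<close> were 0, division by zero would make the load 0 and force
      \<open>\<epsilon> = 1\<close>.\<close>
    have "S \<noteq> 0" using heavy_traffic[OF \<epsilon>(1)] \<epsilon>(3) by (auto simp: load_def S_eq)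
    then have gap: "S - (\<integral>i. lam \<epsilon> i \<partial>\<pi>) = \<epsilon> * S"
      using heavy_traffic[OF \<epsilon>(1)]
      by (simp add: load_def S_eq[symmetric] mean_arrival_rate_def field_simps)
    have e0: "0 \<le> ?e" using s \<epsilon> by simp
    have e_le: "?e \<le> \<epsilon> * (s * exp s)"
    proof -
      have "1 + - ?a \<le> exp (- ?a)" by (rule exp_ge_add_one_self)
      then have "exp ?a * (1 + - ?a) \<le> exp ?a * exp (- ?a)" by (intro mult_left_mono) auto
      then have "?e \<le> ?a * exp ?a" by (simp add: algebra_simps exp_minus_inverse)
      also have "\<dots> \<le> ?a * exp s" using s \<epsilon> by (intro mult_left_mono) auto
      finally show ?thesis by (simp add: mult_ac)
    qed
    have K1: "?K * \<epsilon> = \<epsilon> powr \<beta>"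
      using \<epsilon> powr_add[of \<epsilon> "- 1 / (1 + \<xi>)" 1] by (simp add: \<beta>_def)
    have K2: "?K powr (- \<xi>) = \<epsilon> powr \<beta>"
      by (simp add: powr_powr \<beta>)
    have pw: "\<epsilon> * \<epsilon> powr \<beta> = \<epsilon> powr (2 - 1 / (1 + \<xi>))"
      using \<epsilon> powr_add[of \<epsilon> 1 \<beta>] by (simp add: \<beta>_def)
    have sq: "\<epsilon>\<^sup>2 \<le> \<epsilon> powr (2 - 1 / (1 + \<xi>))"
    proof -
      have "\<epsilon> powr 2 \<le> \<epsilon> powr (2 - 1 / (1 + \<xi>))"
        using \<epsilon> xi by (intro powr_mono') auto
      then show ?thesis using \<epsilon> by (simp add: powr_numeral)
    qed
    have "\<bar>covariance (\<nu> \<epsilon>) (\<lambda>(i, q). X ?a q) (\<lambda>(i, q). f i)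
        - (exp (- ?a) - 1) * (\<integral>x. (case x of (i, q) \<Rightarrow> X ?a q * V i * (lam \<epsilon> i - service i)) \<partial>\<nu> \<epsilon>)\<bar>
      \<le> ?e\<^sup>2 * (M * v) + ?e * (?K * (S - (\<integral>i. lam \<epsilon> i \<partial>\<pi>)) + ?K powr (- \<xi>) * (M * m))"
      unfolding v_def m_def S_def
      using covariance_error_bound[OF poisson moment xi, of ?a ?K] s \<epsilon> by (simp add: service_def)
    also have "?K * (S - (\<integral>i. lam \<epsilon> i \<partial>\<pi>)) + ?K powr (- \<xi>) * (M * m) = \<epsilon> powr \<beta> * (S + M * m)"
      unfolding gap K2 K1[symmetric] by (simp add: algebra_simps)
    also have "?e\<^sup>2 * (M * v) + ?e * (\<epsilon> powr \<beta> * (S + M * m))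
        \<le> (\<epsilon> * (s * exp s))\<^sup>2 * (M * v) + (\<epsilon> * (s * exp s)) * (\<epsilon> powr \<beta> * (S + M * m))"
      using e0 e_le M0 v0 m0 S0
      by (intro add_mono mult_right_mono power_mono mult_nonneg_nonneg add_nonneg_nonneg) auto
    also have "\<dots> = \<epsilon>\<^sup>2 * ((s * exp s)\<^sup>2 * (M * v)) + (\<epsilon> * \<epsilon> powr \<beta>) * ((s * exp s) * (S + M * m))"
      by (simp add: power_mult_distrib mult_ac)
    also have "\<dots> \<le> \<epsilon> powr (2 - 1 / (1 + \<xi>)) * ((s * exp s)\<^sup>2 * (M * v))
        + \<epsilon> powr (2 - 1 / (1 + \<xi>)) * ((s * exp s) * (S + M * m))"
      unfolding pw using sq M0 v0 by (intro add_right_mono mult_right_mono) auto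
    finally show "norm (covariance (measure_pmf (\<nu> \<epsilon>))
                  (\<lambda>(i, q). exp (- s * \<epsilon> * total_queue q)) (\<lambda>(i, q). f i)
              - (exp (- s * \<epsilon>) - 1) *
                measure_pmf.expectation (\<nu> \<epsilon>)
                  (\<lambda>(i, q). exp (- s * \<epsilon> * total_queue q) * V i
                              * (lam \<epsilon> i - (\<Sum>j\<in>UNIV. \<mu> i j))))
        \<le> ((s * exp s)\<^sup>2 * (M * v) + (s * exp s) * (S + M * m)) * norm (\<epsilon> powr (2 - 1 / (1 + \<xi>)))"
      by (simp add: X_def service_def algebra_simps)
  qed (use eps0 in auto)
qed

end
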